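(* Let $n\ge 5$ be odd and $m=\frac{2^n+1}{3}$. Let $\ell\ge 1$ be such that $\rho_{\ell+1}=(1,0,k)$, i.e. $\rho_{\ell+1}=3m+8k$, for some integer $0\le k<m$. Then $$d_{ORD}(C_\ell(P_\infty))=\begin{cases} 2, & \text{if } k=0,\\ 3, & \text{if } 1\le k\le \lfloor \frac{m}{8}\rfloor,\\ 4, & \text{if } \frac{m}{8}<k\le\lfloor\frac{m}{4}\rfloor,\\ 5, & \text{if } \frac{m}{4}<k\le\lfloor\frac{3m}{8}\rfloor,\\ 6, & \text{if } \frac{3m}{8}<k\le\lfloor\frac{m}{2}\rfloor,\\ 8, & \text{if } \frac{m}{2}<k\le\lfloor\frac{3m}{4}\rfloor,\\ 8\left(\lceil k-\frac{3m}{4}\rceil+1\right), & \text{if } \frac{3m}{4}\le k\le m-2,\\ \nu_\ell=2m, & \text{if } k=m-1.\end{cases}$$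
   Context: Let $n\ge5$ be odd, $m=(2^n+1)/3$, and let $GGS(2,n)$ be (the nonsingular model of) the curve $X^2+X=Y^{3}$, $Y^{4}-Y=Z^m$; it is $\mathbb F_{2^{2n}}$-maximal of genus $g=\frac{9m-7}{2}$ and has a unique point at infinity $P_\infty$. The Weierstrass semigroup $H(P_\infty)$ (the set of $r\ge 0$ such that some rational function has pole divisor $rP_\infty$) is known to be $$H(P_\infty)=\{3im+2jm+8k \mid i\in\{0,1\},\ j\in\{0,1,2,3\},\ k\ge0\},$$ and each element has a unique such representation; $(i,j,k)$ denotes the element $3im+2jm+8k$. Write $H(P_\infty)=\{\rho_1=0<\rho_2<\rho_3<\cdots\}$. For $\ell\ge1$, $\nu_\ell$ is the number of ordered pairs $(a,b)\in H(P_\infty)\times H(P_\infty)$ with $a+b=\rho_{\ell+1}$. Let $\overline D$ be the sum of all $\mathbb F_{2^{2n}}$-rational points other than $P_\infty$, and $C_\ell(P_\infty)=C^\perp(\overline D,\rho_\ell P_\infty)$ the dual of the one-point AG code obtained by evaluating $\mathcal L(\rho_\ell P_\infty)$ at the points of $\overline D$. The order bound (Feng-Rao designed minimum distance) is $d_{ORD}(C_\ell(P_\infty))=\min\{\nu_r\mid r\ge\ell\}$. *)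

theory Defs
  imports
    Complex_Main
    "HOL-Library.Infinite_Set"
    "HOL-Computational_Algebra.Polynomial"
begin

text \<open>
  A function field \<open>F/K\<close> is rendered as a field type \<open>'f\<close> (whose universe is \<open>F\<close>) together
  with a subset \<open>K\<close> (the constant field).
\<close>

definition subfield_set :: "'f::field set \<Rightarrow> bool" where
  "subfield_set L \<longleftrightarrow> 1 \<in> L \<and> (\<forall>a\<in>L. \<forall>b\<in>L. a - b \<in> L \<and> a * b \<in> L) \<and> (\<forall>a\<in>L. inverse a \<in> L)"

definition adjoin :: "'f::field set \<Rightarrow> 'f set \<Rightarrow> 'f set" where
  "adjoin K S = \<Inter>{L. subfield_set L \<and> K \<union> S \<subseteq> L}"

definition transcendental_over :: "'f::field set \<Rightarrow> 'f \<Rightarrow> bool" where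
  "transcendental_over K u \<longleftrightarrow> (\<forall>p. (\<forall>i. coeff p i \<in> K) \<and> poly p u = 0 \<longrightarrow> p = 0)"

text \<open>
  The points of the nonsingular model are the places of the function field; a place is
  represented by its valuation ring. Since \<open>inverse 0 = 0\<close>, the case \<open>f = 0\<close> is harmless.
\<close>

definition places :: "'f::field set \<Rightarrow> 'f set set" where
  "places K = {R. K \<subset> R \<and> R \<noteq> UNIV
     \<and> (\<forall>a\<in>R. \<forall>b\<in>R. a - b \<in> R \<and> a * b \<in> R)
     \<and> (\<forall>f. f \<in> R \<or> inverse f \<in> R)}"

definition place_units :: "'f::field set \<Rightarrow> 'f set" where
  "place_units R = {u \<in> R. u \<noteq> 0 \<and> inverse u \<in> R}"

definition uniformizer :: "'f::field set \<Rightarrow> 'f \<Rightarrow> bool" where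
  "uniformizer R t \<longleftrightarrow> t \<noteq> 0 \<and> R - place_units R = (\<lambda>a. t * a) ` R"

text \<open>The normalized discrete valuation of a nonzero \<open>f\<close> at a place.\<close>

definition ord_at :: "'f::field set \<Rightarrow> 'f \<Rightarrow> int" where
  "ord_at R f = (THE v. \<exists>t u. uniformizer R t \<and> u \<in> place_units R \<and> f = t powi v * u)"

text \<open>
  The pole divisor of \<open>f\<close> equals \<open>r P\<close> iff \<open>f\<close> is regular at every other place and has pole
  order \<open>r = max 0 (- v)\<close> at \<open>P\<close>, where \<open>v\<close> is the valuation of \<open>f\<close> at \<open>P\<close>.
\<close>

definition has_pole_divisor :: "'f::field set \<Rightarrow> 'f \<Rightarrow> nat \<Rightarrow> 'f set \<Rightarrow> bool" where
  "has_pole_divisor K f r P \<longleftrightarrow>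
     f \<noteq> 0 \<and> (\<forall>Q\<in>places K. Q \<noteq> P \<longrightarrow> f \<in> Q) \<and> nat (- ord_at P f) = r"

definition weierstrass_semigroup :: "'f::field set \<Rightarrow> 'f set \<Rightarrow> nat set" where
  "weierstrass_semigroup K P = {r. \<exists>f. has_pole_divisor K f r P}"

text \<open>
  The elements of a semigroup are numbered from 1, \<open>\<rho>\<^sub>1 = 0 < \<rho>\<^sub>2 < \<dots>\<close>, whereas
  \<^const>\<open>enumerate\<close> counts from 0.
\<close>

definition rho :: "nat set \<Rightarrow> nat \<Rightarrow> nat" where
  "rho H l = enumerate H (l - 1)"

definition nu :: "nat set \<Rightarrow> nat \<Rightarrow> nat" where
  "nu H l = card {(a, b). a \<in> H \<and> b \<in> H \<and> a + b = rho H (l + 1)}"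

text \<open>
  The order bound (Feng-Rao designed minimum distance) of the code
  \<open>C\<^sub>\<ell>(P) = C\<^sup>\<bottom>(D, \<rho>\<^sub>\<ell> P)\<close>, with \<open>D\<close> the sum of the rational points other than \<open>P\<close>.
  By definition it depends on the point \<open>P\<close> and the index \<open>\<ell>\<close>, not merely on the code as a
  subspace (the latter may coincide for different \<open>\<ell>\<close>). The infimum over a nonempty set of
  naturals is its minimum.
\<close>

definition d_ORD :: "'f::field set \<Rightarrow> 'f set \<Rightarrow> nat \<Rightarrow> nat" where
  "d_ORD K P l = (INF r\<in>{l..}. nu (weierstrass_semigroup K P) r)"

text \<open>
  \<open>F = K(x, y, z)\<close> is the function field of the curve \<open>X\<^sup>2 + X = Y\<^sup>3\<close>, \<open>Y\<^sup>4 - Y = Z\<^sup>m\<close> over the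
  field \<open>K\<close> with \<open>2\<^sup>2\<^sup>n\<close> elements, \<open>x\<close>, \<open>y\<close>, \<open>z\<close> being the coordinate functions. Transcendence
  of \<open>z\<close> says that \<open>(x, y, z)\<close> is a generic point of the curve: the curve is irreducible, so the
  kernel of \<open>K[X, Y, Z] \<rightarrow> F\<close> is then generated by the two equations.
\<close>

locale GGS2_function_field =
  fixes n :: nat and m :: nat and K :: "'f::field set" and x y z :: 'f
  assumes m_eq: "m = (2 ^ n + 1) div 3"
    and subfield_K: "subfield_set K"
    and card_K: "finite K" "card K = 2 ^ (2 * n)"
    and curve1: "x ^ 2 + x = y ^ 3"
    and curve2: "y ^ 4 - y = z ^ m"
    and transcendental_z: "transcendental_over K z"
    and generated: "adjoin K {x, y, z} = UNIV"

text \<open>Points at infinity: the places at which some affine coordinate function has a pole.\<close>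

definition point_at_infinity :: "'f::field set \<Rightarrow> 'f \<Rightarrow> 'f \<Rightarrow> 'f \<Rightarrow> 'f set \<Rightarrow> bool" where
  "point_at_infinity K x y z P \<longleftrightarrow> P \<in> places K \<and> \<not> {x, y, z} \<subseteq> P"

end

theory Submission
  imports Defs
begin

text \<open>
  Let \<open>w = y\<^sup>2 + y\<close>. The coordinate ring \<open>K[x, y, z]\<close> is a tower of three Artin-Schreier
  extensions of \<open>K[z]\<close>, generated by \<open>w\<close>, \<open>y\<close> and \<open>x\<close>, where each generator \<open>t\<close> satisfies
  \<open>t\<^sup>2 + t \<in> S\<close> over the preceding ring \<open>S\<close>. At a place where a coordinate has a pole, \<open>f\<^sup>8\<close> is a unit
  times \<open>z\<^sup>d\<close>, with \<open>d\<close> equal to \<open>8\<close>, \<open>4 m\<close>, \<open>2 m\<close>, \<open>3 m\<close> for \<open>z\<close>, \<open>w\<close>, \<open>y\<close>, \<open>x\<close>. Since \<open>m\<close> is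
  odd, the two terms of \<open>a + b t\<close> never have the same order, so no cancellation occurs: the orders
  of the nonzero elements of \<open>K[x, y, z]\<close> are exactly the numbers \<open>3 i m + 2 j m + 8 k\<close>, and the
  place at infinity is unique. A function regular at all other places is integral over
  \<open>K[x, y, z]\<close>, which is integrally closed because every extension in the tower has the derivative 1.
  The order bound is then a count of pairs, done one residue class modulo 8 at a time.
\<close>

section \<open>Subrings and valuation rings of a field\<close>

definition subring_set :: "'f::field set \<Rightarrow> bool" where
  "subring_set S \<longleftrightarrow> 1 \<in> S \<and> (\<forall>a\<in>S. \<forall>b\<in>S. a - b \<in> S \<and> a * b \<in> S)"

definition ring_adjoin :: "'f::field set \<Rightarrow> 'f \<Rightarrow> 'f set" where
  "ring_adjoin S u = {poly p u | p. \<forall>i. coeff p i \<in> S}"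

definition valuation_ring_set :: "'f::field set \<Rightarrow> bool" where
  "valuation_ring_set R \<longleftrightarrow> subring_set R \<and> (\<forall>f. f \<in> R \<or> inverse f \<in> R)"

section \<open>Closure properties of subrings and adjunction of one element\<close>

context
  fixes S :: "'f::field set"
  assumes S: "subring_set S"
begin

lemma subring_one: "1 \<in> S"
  and subring_diff: "a \<in> S \<Longrightarrow> b \<in> S \<Longrightarrow> a - b \<in> S"
  and subring_mult: "a \<in> S \<Longrightarrow> b \<in> S \<Longrightarrow> a * b \<in> S"
  using S by (auto simp: subring_set_def)

lemma subring_zero: "0 \<in> S"
  using subring_diff[OF subring_one subring_one] by simp

lemma subring_uminus: "a \<in> S \<Longrightarrow> - a \<in> S"
  using subring_diff[OF subring_zero] by simp

lemma subring_add: "a \<in> S \<Longrightarrow> b \<in> S \<Longrightarrow> a + b \<in> S"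
  using subring_diff[of a "- b"] subring_uminus by simp

lemma subring_power: "a \<in> S \<Longrightarrow> a ^ k \<in> S"
  by (induction k) (auto intro: subring_one subring_mult)

lemma subring_sum: "(\<And>i. i \<in> I \<Longrightarrow> g i \<in> S) \<Longrightarrow> sum g I \<in> S"
  by (induction I rule: infinite_finite_induct) (auto intro: subring_zero subring_add)

lemmas subring_closed = subring_one subring_diff subring_mult subring_zero subring_uminus
  subring_add subring_power subring_sum

lemma coeffs_mult_closed:
  "(\<And>i. coeff p i \<in> S) \<Longrightarrow> (\<And>i. coeff q i \<in> S) \<Longrightarrow> coeff (p * q) i \<in> S"
  by (auto simp: coeff_mult intro!: subring_closed)

lemma coeffs_pCons_closed: "a \<in> S \<Longrightarrow> (\<And>i. coeff p i \<in> S) \<Longrightarrow> coeff (pCons a p) i \<in> S"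
  by (cases i) auto

lemma ring_adjoin_base: "a \<in> S \<Longrightarrow> a \<in> ring_adjoin S u"
  unfolding ring_adjoin_def
  by (auto intro!: exI[of _ "[:a:]"] coeffs_pCons_closed subring_closed)

lemma ring_adjoin_generator: "u \<in> ring_adjoin S u"
  unfolding ring_adjoin_def
  by (auto intro!: exI[of _ "[:0, 1:]"] coeffs_pCons_closed subring_closed)

lemma subring_ring_adjoin: "subring_set (ring_adjoin S u)"
  unfolding subring_set_def
proof (intro conjI ballI)
  show "1 \<in> ring_adjoin S u" by (intro ring_adjoin_base subring_one)
  fix a b assume "a \<in> ring_adjoin S u" "b \<in> ring_adjoin S u"
  then obtain p q where p: "a = poly p u" "\<forall>i. coeff p i \<in> S"
    and q: "b = poly q u" "\<forall>i. coeff q i \<in> S"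
    by (auto simp: ring_adjoin_def)
  show "a - b \<in> ring_adjoin S u" using p q unfolding ring_adjoin_def
    by (auto intro!: exI[of _ "p - q"] subring_closed)
  show "a * b \<in> ring_adjoin S u" using p q unfolding ring_adjoin_def
    by (auto intro!: exI[of _ "p * q"] coeffs_mult_closed)
qed

end

lemma ring_adjoin_least:
  assumes T: "subring_set T" and "S \<subseteq> T" "u \<in> T"
  shows "ring_adjoin S u \<subseteq> T"
proof
  fix a assume "a \<in> ring_adjoin S u"
  then obtain p where "a = poly p u" "\<forall>i. coeff p i \<in> S"
    by (auto simp: ring_adjoin_def)
  then show "a \<in> T"
    using assms by (auto simp: poly_altdef intro!: subring_closed[OF T])
qed

subsection \<open>Existence of valuation rings\<close>

text \<open>The ring \<open>ring_adjoin S u\<close> filtered by degree, so that a relation of least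
  degree can be selected.\<close>

definition poly_values :: "'f::field set \<Rightarrow> 'f \<Rightarrow> nat \<Rightarrow> 'f set" where
  "poly_values S u d = {poly p u | p. (\<forall>i. coeff p i \<in> S) \<and> degree p \<le> d}"

lemma ring_adjoin_eq_poly_values: "ring_adjoin S u = (\<Union>d. poly_values S u d)"
  by (auto simp: ring_adjoin_def poly_values_def)

lemma poly_values_expand:
  assumes f: "f \<in> poly_values S u d"
  shows "\<exists>c. (\<forall>i. c i \<in> S) \<and> f = (\<Sum>i\<le>d. c i * u ^ i)"
proof -
  from f obtain p where p: "f = poly p u" "\<forall>i. coeff p i \<in> S" "degree p \<le> d"
    by (auto simp: poly_values_def)
  have "(\<Sum>i\<le>degree p. coeff p i * u ^ i) = (\<Sum>i\<le>d. coeff p i * u ^ i)"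
    using p(3) by (intro sum.mono_neutral_left) (auto simp: coeff_eq_0)
  then show ?thesis using p by (auto simp: poly_altdef)
qed

lemma poly_values_sum:
  assumes S: "subring_set S" and fin: "finite I"
    and c: "\<And>i. i \<in> I \<Longrightarrow> c i \<in> S" and e: "\<And>i. i \<in> I \<Longrightarrow> e i \<le> d"
  shows "(\<Sum>i\<in>I. c i * u ^ e i) \<in> poly_values S u d"
proof -
  let ?p = "\<Sum>i\<in>I. monom (c i) (e i)"
  have "coeff ?p k \<in> S" for k
    using c by (auto simp: coeff_sum intro!: subring_closed[OF S])
  moreover have "degree ?p \<le> d"
    using e by (intro degree_sum_le fin) (meson degree_monom_le le_trans)
  moreover have "poly ?p u = (\<Sum>i\<in>I. c i * u ^ e i)"
    by (simp add: poly_sum poly_monom)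
  ultimately show ?thesis unfolding poly_values_def by (intro CollectI exI[of _ ?p]) auto
qed

lemma poly_values_add:
  assumes "subring_set S" "a \<in> poly_values S u d" "b \<in> poly_values S u d"
  shows "a + b \<in> poly_values S u d"
proof -
  obtain p q where "a = poly p u" "\<forall>i. coeff p i \<in> S" "degree p \<le> d"
    "b = poly q u" "\<forall>i. coeff q i \<in> S" "degree q \<le> d"
    using assms by (auto simp: poly_values_def)
  then show ?thesis unfolding poly_values_def
    by (auto intro!: exI[of _ "p + q"] subring_closed[OF assms(1)] degree_add_le)
qed

text \<open>The lower of the two relations expresses \<open>1\<close> through negative powers of \<open>u\<close>; multiplied by
  the leading term of the higher one it lowers the degree of the latter.\<close>

lemma poly_values_reduce:
  assumes S: "subring_set S" and w: "inverse f \<in> S" and f: "f \<noteq> 0" and u: "u \<noteq> 0"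
    and local_inv: "\<And>c. c \<in> S \<Longrightarrow> inverse (1 - inverse f * c) \<in> S \<and> 1 - inverse f * c \<noteq> 0"
    and fu: "f \<in> poly_values S u n" and fi: "f \<in> poly_values S (inverse u) k"
    and "k \<le> n" "0 < k"
  shows "f \<in> poly_values S u (n - 1)"
proof -
  obtain a where a: "\<And>i. a i \<in> S" "f = (\<Sum>i\<le>n. a i * u ^ i)"
    using poly_values_expand[OF fu] by blast
  obtain b where b: "\<And>i. b i \<in> S" "f = (\<Sum>i\<le>k. b i * inverse u ^ i)"
    using poly_values_expand[OF fi] by blast
  define w where "w = inverse f"
  define e where "e = 1 - w * b 0"
  have e: "inverse e \<in> S" "e \<noteq> 0"
    using local_inv[of "b 0"] b(1) by (auto simp: e_def w_def)
  have "f = b 0 + (\<Sum>i=1..k. b i * inverse u ^ i)"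
    unfolding b(2) by (simp add: atMost_atLeast0 sum.atLeast_Suc_atMost)
  then have "w * f = w * b 0 + w * (\<Sum>i=1..k. b i * inverse u ^ i)"
    by (simp add: algebra_simps)
  moreover have "w * f = 1" using f by (simp add: w_def)
  ultimately have e_eq: "e = w * (\<Sum>i=1..k. b i * inverse u ^ i)"
    by (simp add: e_def algebra_simps)
  have "u ^ n * e = (\<Sum>i=1..k. w * b i * (u ^ n * inverse u ^ i))"
    by (simp add: e_eq sum_distrib_left mult_ac)
  also have "\<dots> = (\<Sum>i=1..k. w * b i * u ^ (n - i))"
    using \<open>k \<le> n\<close> u by (intro sum.cong) (auto simp: power_diff field_simps)
  finally have "a n * inverse e * (u ^ n * e) = (\<Sum>i=1..k. (a n * inverse e * w * b i) * u ^ (n - i))"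
    by (simp add: sum_distrib_left mult_ac)
  moreover have "a n * inverse e * (u ^ n * e) = a n * u ^ n"
    using e(2) by (simp add: field_simps)
  ultimately have "a n * u ^ n = (\<Sum>i=1..k. (a n * inverse e * w * b i) * u ^ (n - i))"
    by simp
  moreover have "(\<Sum>i=1..k. (a n * inverse e * w * b i) * u ^ (n - i)) \<in> poly_values S u (n - 1)"
    using a(1) b(1) e(1) \<open>inverse f \<in> S\<close>
    by (intro poly_values_sum[OF S]) (auto simp: w_def intro!: subring_closed[OF S])
  moreover have "(\<Sum>i<n. a i * u ^ i) \<in> poly_values S u (n - 1)"
    using a(1) by (intro poly_values_sum[OF S]) auto
  moreover have "f = (\<Sum>i<n. a i * u ^ i) + a n * u ^ n"
    using a(2) by (simp add: lessThan_Suc_atMost[symmetric])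
  ultimately show ?thesis using poly_values_add[OF S] by metis
qed

text \<open>By maximality any \<open>u\<close> outside \<open>S\<close> satisfies
  \<open>f \<in> ring_adjoin S u\<close>. If \<open>u\<close> and \<open>inverse u\<close> were both
  outside, the two expressions of \<open>f\<close> of least degree could be played against each
  other by \<open>poly_values_reduce\<close>.\<close>

lemma maximal_subring_avoiding_is_valuation_ring:
  assumes S: "subring_set S" and w: "inverse f \<in> S" and f: "f \<notin> S"
    and maximal: "\<And>T. subring_set T \<Longrightarrow> S \<subseteq> T \<Longrightarrow> f \<notin> T \<Longrightarrow> T = S"
  shows "valuation_ring_set S"
proof -
  note closed = subring_closed[OF S]
  have f0: "f \<noteq> 0" using f closed(4) by auto
  have adjoin_f: "f \<in> ring_adjoin S u" if "u \<notin> S" for u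
    using maximal[OF subring_ring_adjoin[OF S], of u] ring_adjoin_base[OF S]
      ring_adjoin_generator[OF S, of u] that by blast
  \<comment> \<open>\<open>inverse f\<close> lies in the Jacobson radical of \<open>S\<close>.
    Otherwise \<open>f\<close> would be a polynomial in \<open>inverse e\<close>; clearing
    denominators gives \<open>f * e ^ d \<in> S\<close>, and as \<open>e ^ d\<close> is 1 minus a
    multiple of \<open>inverse f\<close>, this forces \<open>f \<in> S\<close>.\<close>
  have local_inv: "inverse (1 - inverse f * c) \<in> S \<and> 1 - inverse f * c \<noteq> 0" if c: "c \<in> S" for c
  proof -
    define e where "e = 1 - inverse f * c"
    have eS: "e \<in> S" using c w by (auto simp: e_def intro!: closed)
    have e0: "e \<noteq> 0"
    proof
      assume "e = 0"
      then have "c = f" using f0 by (simp add: e_def field_simps)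
      with c f show False by simp
    qed
    have pow: "\<exists>t\<in>S. e ^ N = 1 - inverse f * t" for N
    proof (induction N)
      case 0
      show ?case by (rule bexI[of _ 0]) (auto intro: closed)
    next
      case (Suc N)
      then obtain t where t: "t \<in> S" "e ^ N = 1 - inverse f * t" by blast
      have "e ^ Suc N = 1 - inverse f * (c + t - inverse f * c * t)"
        by (simp add: t(2)) (simp add: e_def algebra_simps)
      moreover have "c + t - inverse f * c * t \<in> S" using c t w by (auto intro!: closed)
      ultimately show ?case by blast
    qed
    have "inverse e \<in> S"
    proof (rule ccontr)
      assume "inverse e \<notin> S"
      then obtain d where "f \<in> poly_values S (inverse e) d"
        using adjoin_f by (auto simp: ring_adjoin_eq_poly_values)
      then obtain a where a: "\<And>i. a i \<in> S" "f = (\<Sum>i\<le>d. a i * inverse e ^ i)"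
        using poly_values_expand by blast
      have "f * e ^ d = (\<Sum>i\<le>d. a i * (inverse e ^ i * e ^ d))"
        by (subst a(2)) (simp add: sum_distrib_right mult.assoc)
      also have "\<dots> = (\<Sum>i\<le>d. a i * e ^ (d - i))"
        using e0 by (intro sum.cong) (auto simp: power_diff field_simps)
      finally have "f * e ^ d \<in> S"
        using a(1) eS by (auto intro!: closed)
      moreover obtain t where "t \<in> S" "e ^ d = 1 - inverse f * t" using pow by blast
      ultimately have "f * (1 - inverse f * t) + t \<in> S" by (auto intro!: closed)
      moreover have "f * (1 - inverse f * t) + t = f" using f0 by (simp add: field_simps)
      ultimately show False using f by simp
    qed
    with e0 show ?thesis by (simp add: e_def)
  qed
  have "u \<in> S \<or> inverse u \<in> S" for u
  proof (rule ccontr)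
    assume "\<not> (u \<in> S \<or> inverse u \<in> S)"
    then have u: "u \<notin> S" "inverse u \<notin> S" by auto
    then have u0: "u \<noteq> 0" using closed(4) by auto
    define deg where "deg v = (LEAST d. f \<in> poly_values S v d)" for v
    have deg: "f \<in> poly_values S v (deg v)" "f \<in> poly_values S v d \<Longrightarrow> deg v \<le> d"
      if "v \<notin> S" for v d
      using adjoin_f[OF that] unfolding deg_def ring_adjoin_eq_poly_values
      by (auto intro: LeastI Least_le)
    have pos: "0 < deg v" if "v \<notin> S" for v
    proof (rule ccontr)
      assume "\<not> 0 < deg v"
      with deg(1)[OF that] obtain p where "f = poly p v" "\<forall>i. coeff p i \<in> S" "degree p = 0"
        by (auto simp: poly_values_def)
      then have "f \<in> S" by (auto elim!: degree_eq_zeroE) (metis coeff_pCons_0)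
      with f show False by simp
    qed
    \<comment> \<open>The situation is symmetric in \<open>u\<close> and \<open>inverse u\<close>,
      so the one with the larger least degree may be called \<open>v\<close>.\<close>
    have False if "v \<notin> S" "inverse v \<notin> S" "deg (inverse v) \<le> deg v" for v
    proof -
      have "v \<noteq> 0" using that closed(4) by auto
      then have "f \<in> poly_values S v (deg v - 1)"
        using poly_values_reduce[OF S w f0 _ local_inv deg(1) deg(1)] that pos by blast
      then have "deg v \<le> deg v - 1" using deg(2) that by blast
      with pos[OF that(1)] show False by simp
    qed
    from this[of u] this[of "inverse u"] u show False
      by (cases "deg u" "deg (inverse u)" rule: le_cases) simp_all
  qed
  with S show ?thesis by (auto simp: valuation_ring_set_def)
qed

text \<open>The hypothesis says that \<open>f\<close> is not integral over \<open>A\<close>. Zorn's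
  lemma is applied to subrings avoiding \<open>f\<close> that contain \<open>inverse f\<close> as
  well as \<open>A\<close>, because the preceding lemma needs the inverse inside.\<close>

lemma valuation_ring_avoiding_exists:
  assumes A: "subring_set A" and f: "f \<notin> ring_adjoin A (inverse f)"
  obtains R where "valuation_ring_set R" "A \<subseteq> R" "f \<notin> R"
proof -
  define B where "B = ring_adjoin A (inverse f)"
  define \<A> where "\<A> = {S. subring_set S \<and> B \<subseteq> S \<and> f \<notin> S}"
  have "B \<in> \<A>" using f subring_ring_adjoin[OF A] by (auto simp: \<A>_def B_def)
  have "\<exists>M\<in>\<A>. \<forall>X\<in>\<A>. M \<subseteq> X \<longrightarrow> X = M"
  proof (rule subset_Zorn_nonempty)
    show "\<A> \<noteq> {}" using \<open>B \<in> \<A>\<close> by blast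
    fix \<C> assume ne: "\<C> \<noteq> {}" and ch: "subset.chain \<A> \<C>"
    have sub: "S \<in> \<C> \<Longrightarrow> subring_set S \<and> B \<subseteq> S \<and> f \<notin> S" for S
      using ch by (auto simp: subset.chain_def \<A>_def)
    have "subring_set (\<Union>\<C>)" unfolding subring_set_def
    proof (intro conjI ballI)
      show "1 \<in> \<Union>\<C>" using ne sub subring_one by blast
      fix a b assume "a \<in> \<Union>\<C>" "b \<in> \<Union>\<C>"
      then obtain S T where "S \<in> \<C>" "T \<in> \<C>" "a \<in> S" "b \<in> T" by blast
      moreover have "S \<subseteq> T \<or> T \<subseteq> S"
        using ch calculation by (auto simp: subset_chain_def)
      ultimately obtain U where U: "U \<in> \<C>" "a \<in> U" "b \<in> U" by blast
      then show "a - b \<in> \<Union>\<C>" "a * b \<in> \<Union>\<C>"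
        using sub[OF U(1)] subring_diff subring_mult by blast+
    qed
    with sub ne show "\<Union>\<C> \<in> \<A>" by (auto simp: \<A>_def)
  qed
  then obtain M where M: "M \<in> \<A>" and maximal: "\<And>X. X \<in> \<A> \<Longrightarrow> M \<subseteq> X \<Longrightarrow> X = M"
    by blast
  have "valuation_ring_set M"
    using M maximal ring_adjoin_generator[OF A, of "inverse f"]
    by (intro maximal_subring_avoiding_is_valuation_ring[of _ f]) (auto simp: \<A>_def B_def)
  moreover have "A \<subseteq> M" using M ring_adjoin_base[OF A] by (auto simp: \<A>_def B_def)
  ultimately show ?thesis using M that by (auto simp: \<A>_def)
qed

subsection \<open>Units of a valuation ring\<close>

context
  fixes R :: "'f::field set"
  assumes R: "valuation_ring_set R"
begin

lemma valuation_ring_subring: "subring_set R"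
  and valuation_ring_inverse: "f \<notin> R \<Longrightarrow> inverse f \<in> R"
  using R by (auto simp: valuation_ring_set_def)

private lemmas closed = subring_closed[OF valuation_ring_subring]

lemma place_units_one: "1 \<in> place_units R"
  and place_units_inverse: "u \<in> place_units R \<Longrightarrow> inverse u \<in> place_units R"
  and place_units_mult: "u \<in> place_units R \<Longrightarrow> v \<in> place_units R \<Longrightarrow> u * v \<in> place_units R"
  by (auto simp: place_units_def intro: closed)

lemma place_units_power: "u \<in> place_units R \<Longrightarrow> u ^ k \<in> place_units R"
  by (induction k) (auto intro: place_units_one place_units_mult)

lemma place_units_mult_mem_iff: "u \<in> place_units R \<Longrightarrow> u * f \<in> R \<longleftrightarrow> f \<in> R"
  using closed(3)[of "inverse u" "u * f"] closed(3)[of u f]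
  by (auto simp: place_units_def simp flip: mult.assoc)

text \<open>If \<open>f\<close> were outside, its inverse would be inside, and \<open>f\<close> is
  \<open>f ^ k\<close> times \<open>inverse f ^ (k - 1)\<close>.\<close>

lemma valuation_ring_power_iff: "0 < k \<Longrightarrow> f ^ k \<in> R \<longleftrightarrow> f \<in> R"
proof
  assume k: "0 < k" and fk: "f ^ k \<in> R"
  show "f \<in> R"
  proof (rule ccontr)
    assume f: "f \<notin> R"
    then have "f \<noteq> 0" using closed(4) by auto
    have "f ^ k * inverse f ^ (k - 1) \<in> R"
      using fk valuation_ring_inverse[OF f] closed(3,7) by blast
    moreover have "f ^ k = f * f ^ (k - 1)"
      using k by (simp flip: power_Suc)
    ultimately show False using f \<open>f \<noteq> 0\<close> by (simp add: power_inverse mult.assoc)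
  qed
qed (rule closed(7))

text \<open>The basis of all leading-term arguments: where \<open>f\<close> has a pole, so has
  \<open>1 + f\<close>, and the required inverse is \<open>1 - inverse (1 + f)\<close>.\<close>

lemma one_plus_inverse_unit:
  assumes "f \<notin> R"
  shows "1 + inverse f \<in> place_units R"
proof -
  have "1 + f \<notin> R" using closed(2)[of "1 + f" 1] closed(1) assms by auto
  then have i: "inverse (1 + f) \<in> R" "1 + f \<noteq> 0"
    using valuation_ring_inverse closed(4) by auto
  have f0: "f \<noteq> 0" using assms closed(4) by auto
  have "1 + inverse f \<noteq> 0" using f0 i(2) by (simp add: field_simps)
  moreover have "inverse (1 + inverse f) = 1 - inverse (1 + f)"
    using f0 i(2) calculation by (simp add: field_simps)
  ultimately show ?thesis
    using i valuation_ring_inverse[OF assms] by (auto simp: place_units_def intro!: closed)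
qed

lemma powi_mem_valuation_ring_iff:
  assumes "f \<notin> R"
  shows "f powi i \<in> R \<longleftrightarrow> i \<le> 0"
proof (cases "i \<le> 0")
  case True
  then show ?thesis using closed(7)[OF valuation_ring_inverse[OF assms]]
    by (cases "i = 0") (auto simp: power_int_def intro: closed)
next
  case False
  then show ?thesis using assms by (simp add: power_int_def valuation_ring_power_iff)
qed

end

section \<open>Pole orders at infinity\<close>

text \<open>Translation by 1 permutes \<open>K\<close>, so it leaves the sum over \<open>K\<close>
  unchanged although it adds \<open>card K\<close> to it. This yields characteristic 2.\<close>

lemma finite_subfield_of_nat_card_eq_0:
  fixes K :: "'f::field set"
  assumes K: "subfield_set K" and fin: "finite K"
  shows "of_nat (card K) = (0 :: 'f)"
proof -
  have sub: "subring_set K" using K by (simp add: subfield_set_def subring_set_def)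
  have "bij_betw (\<lambda>a. a + 1) K K"
    using subring_closed[OF sub]
    by (intro bij_betw_byWitness[where f' = "\<lambda>a. a - 1"]) auto
  then have "(\<Sum>a\<in>K. a + 1) = \<Sum>K"
    by (rule sum.reindex_bij_betw[where g = "\<lambda>a. a"])
  then show ?thesis by (simp add: sum.distrib)
qed

text \<open>Oddness makes \<open>2 ^ n + 1\<close> divisible by 3, and \<open>3 \<le> n\<close>
  makes \<open>3 * m\<close> congruent to 1 modulo 8.\<close>

locale GGS2_odd = GGS2_function_field n m K x y z
  for n m :: nat and K :: "'f::field set" and x y z :: 'f +
  assumes n_odd: "odd n" and n_ge: "3 \<le> n"
begin

section \<open>Arithmetic of \<open>m\<close> and characteristic 2\<close>

lemma three_m: "3 * m = 2 ^ n + 1"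
proof -
  obtain k where n: "n = 2 * k + 1" using n_odd by (auto elim: oddE)
  have "(4 :: nat) ^ k mod 3 = 1"
    by (induction k) (auto simp: mod_mult_eq[symmetric, of 4])
  then have "(2 ^ n + 1 :: nat) mod 3 = 0"
    unfolding n by (simp add: power_mult) presburger
  then show ?thesis using m_eq by auto
qed

lemma m_mod_8: "m mod 8 = 3"
proof -
  obtain j where "n = 3 + j" using n_ge by (auto simp: le_iff_add)
  then have "3 * m = 8 * 2 ^ j + 1" using three_m by (simp add: power_add)
  then show ?thesis by presburger
qed

lemma m_pos: "0 < m" using m_mod_8 by (cases m) auto

lemma two_eq_0: "(2 :: 'f) = 0"
  using finite_subfield_of_nat_card_eq_0[OF subfield_K card_K(1)]
  by (simp add: card_K(2))

lemma minus_eq: "- a = (a :: 'f)" and add_self: "a + a = (0 :: 'f)"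
proof -
  show "a + a = 0" using two_eq_0 by (metis mult_2 mult_zero_left)
  then show "- a = a" by (simp add: eq_neg_iff_add_eq_0 neg_eq_iff_add_eq_0)
qed

lemma subring_K: "subring_set K"
  using subfield_K by (simp add: subfield_set_def subring_set_def)

text \<open>Pole order \<open>d\<close>, positive for poles, measured against \<open>z\<close>,
  which gets order 8. The eighth power clears the ramification, so no uniformizer has to be known
  yet.\<close>

definition zdeg :: "'f set \<Rightarrow> 'f \<Rightarrow> int \<Rightarrow> bool" where
  "zdeg Q f d \<longleftrightarrow> (\<exists>u\<in>place_units Q. f ^ 8 = u * z powi d)"

lemma place_valuation_ring: "Q \<in> places K \<Longrightarrow> valuation_ring_set Q"
  using subfield_K by (auto simp: places_def valuation_ring_set_def subring_set_def subfield_set_def)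

lemma K_units: "Q \<in> places K \<Longrightarrow> c \<in> K \<Longrightarrow> c \<noteq> 0 \<Longrightarrow> c \<in> place_units Q"
  using subfield_K by (auto simp: places_def place_units_def subfield_set_def)

context
  fixes Q :: "'f set"
  assumes Q: "point_at_infinity K x y z Q"
begin

lemma infinity_place: "Q \<in> places K"
  and infinity_valuation_ring: "valuation_ring_set Q"
  using Q place_valuation_ring by (auto simp: point_at_infinity_def)

private lemmas vr = infinity_valuation_ring

private lemmas closed = subring_closed[OF valuation_ring_subring[OF vr]]

text \<open>If \<open>y\<close> has a pole then \<open>y ^ 4\<close> dominates
  \<open>y ^ 4 - y\<close>, the quotient being \<open>1 + inverse (y ^ 3)\<close> in characteristic
  2; likewise \<open>x ^ 2\<close> dominates \<open>x ^ 2 + x\<close>.\<close>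

lemma infinity_leading_factors:
  "y \<notin> Q \<Longrightarrow> \<exists>u\<in>place_units Q. z ^ m = u * y ^ 4"
  "x \<notin> Q \<Longrightarrow> \<exists>u\<in>place_units Q. y ^ 3 = u * x ^ 2"
proof -
  assume y: "y \<notin> Q"
  then have "y \<noteq> 0" using closed(4) by auto
  then have "z ^ m = (1 + inverse (y ^ 3)) * y ^ 4"
    unfolding curve2[symmetric] using minus_eq[of y] by (simp add: field_simps eval_nat_numeral)
  moreover have "y ^ 3 \<notin> Q" using y valuation_ring_power_iff[OF vr, of 3] by simp
  ultimately show "\<exists>u\<in>place_units Q. z ^ m = u * y ^ 4"
    using one_plus_inverse_unit[OF vr] by blast
next
  assume x: "x \<notin> Q"
  then have "x \<noteq> 0" using closed(4) by auto
  then have "y ^ 3 = (1 + inverse x) * x ^ 2"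
    unfolding curve1[symmetric] by (simp add: field_simps eval_nat_numeral)
  then show "\<exists>u\<in>place_units Q. y ^ 3 = u * x ^ 2"
    using one_plus_inverse_unit[OF vr x] by blast
qed

text \<open>A power is regular exactly when its base is, so the two equations pass a pole of one
  coordinate on to the others.\<close>

lemma infinity_poles: "z \<notin> Q" "y \<notin> Q" "x \<notin> Q"
proof -
  have zy: "z \<in> Q \<longleftrightarrow> y \<in> Q"
  proof
    assume "z \<in> Q"
    show "y \<in> Q"
    proof (rule ccontr)
      assume "y \<notin> Q"
      then obtain u where "u \<in> place_units Q" "z ^ m = u * y ^ 4"
        using infinity_leading_factors(1) by blast
      with \<open>z \<in> Q\<close> have "y ^ 4 \<in> Q" using place_units_mult_mem_iff[OF vr] closed(7) by metis
      with \<open>y \<notin> Q\<close> show False using valuation_ring_power_iff[OF vr, of 4] by simp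
    qed
  next
    assume "y \<in> Q"
    then have "z ^ m \<in> Q" unfolding curve2[symmetric] by (intro closed)
    then show "z \<in> Q" using m_pos valuation_ring_power_iff[OF vr] by simp
  qed
  have yx: "y \<in> Q \<longleftrightarrow> x \<in> Q"
  proof
    assume "y \<in> Q"
    show "x \<in> Q"
    proof (rule ccontr)
      assume "x \<notin> Q"
      then obtain u where "u \<in> place_units Q" "y ^ 3 = u * x ^ 2"
        using infinity_leading_factors(2) by blast
      with \<open>y \<in> Q\<close> have "x ^ 2 \<in> Q" using place_units_mult_mem_iff[OF vr] closed(7) by metis
      with \<open>x \<notin> Q\<close> show False using valuation_ring_power_iff[OF vr, of 2] by simp
    qed
  next
    assume "x \<in> Q"
    then have "y ^ 3 \<in> Q" unfolding curve1[symmetric] by (intro closed)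
    then show "y \<in> Q" using valuation_ring_power_iff[OF vr] by simp
  qed
  show "z \<notin> Q" "y \<notin> Q" "x \<notin> Q"
    using Q zy yx by (auto simp: point_at_infinity_def)
qed

section \<open>Calculus of pole orders\<close>

lemma z_nonzero: "z \<noteq> 0"
  using infinity_poles(1) closed(4) by auto

lemma zdeg_nonzero: "zdeg Q f d \<Longrightarrow> f \<noteq> 0"
  using z_nonzero by (auto simp: zdeg_def place_units_def)

lemma zdeg_mult: "zdeg Q f d \<Longrightarrow> zdeg Q g e \<Longrightarrow> zdeg Q (f * g) (d + e)"
  unfolding zdeg_def
proof (elim bexE)
  fix u v assume "u \<in> place_units Q" "f ^ 8 = u * z powi d" "v \<in> place_units Q" "g ^ 8 = v * z powi e"
  then show "\<exists>u\<in>place_units Q. (f * g) ^ 8 = u * z powi (d + e)"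
    using z_nonzero
    by (intro bexI[of _ "u * v"] place_units_mult[OF vr])
      (auto simp: power_mult_distrib power_int_add)
qed

lemma zdeg_inverse: "zdeg Q f d \<Longrightarrow> zdeg Q (inverse f) (- d)"
  unfolding zdeg_def
proof (elim bexE)
  fix u assume "u \<in> place_units Q" "f ^ 8 = u * z powi d"
  then show "\<exists>u\<in>place_units Q. inverse f ^ 8 = u * z powi (- d)"
    by (intro bexI[of _ "inverse u"] place_units_inverse[OF vr])
      (auto simp: power_inverse power_int_minus)
qed

lemma zdeg_unit: "u \<in> place_units Q \<Longrightarrow> zdeg Q u 0"
  using place_units_power[OF vr] by (auto simp: zdeg_def)

lemma zdeg_mem_iff: "zdeg Q f d \<Longrightarrow> f \<in> Q \<longleftrightarrow> d \<le> 0"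
proof -
  assume "zdeg Q f d"
  then obtain u where "u \<in> place_units Q" "f ^ 8 = u * z powi d" by (auto simp: zdeg_def)
  moreover have "f \<in> Q \<longleftrightarrow> f ^ 8 \<in> Q" using valuation_ring_power_iff[OF vr] by simp
  ultimately show ?thesis
    using place_units_mult_mem_iff[OF vr] powi_mem_valuation_ring_iff[OF vr infinity_poles(1)]
    by simp
qed

lemma zdeg_unit_iff: "zdeg Q f d \<Longrightarrow> f \<in> place_units Q \<longleftrightarrow> d = 0"
  using zdeg_mem_iff[of f d] zdeg_mem_iff[OF zdeg_inverse, of f d] zdeg_nonzero[of f d]
  by (auto simp: place_units_def)

lemma zdeg_unique: "zdeg Q f d \<Longrightarrow> zdeg Q f e \<Longrightarrow> d = e"
  using zdeg_unit_iff[OF zdeg_mult[OF _ zdeg_inverse], of f d f e] zdeg_nonzero[of f d]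
    place_units_one[OF vr] by auto

lemma zdeg_power: "zdeg Q f d \<Longrightarrow> zdeg Q (f ^ k) (int k * d)"
proof (induction k)
  case 0
  then show ?case using zdeg_unit place_units_one[OF vr] by simp
next
  case (Suc k)
  then show ?case using zdeg_mult[of f d "f ^ k" "int k * d"] by (simp add: algebra_simps)
qed

lemma zdeg_powi: "zdeg Q f d \<Longrightarrow> zdeg Q (f powi i) (i * d)"
  using zdeg_power[of f d "nat i"] zdeg_power[OF zdeg_inverse, of f d "nat (- i)"]
  by (cases "0 \<le> i") (auto simp: power_int_def)

text \<open>\<open>f + g\<close> is \<open>f\<close> times
  \<open>1 + inverse (f * inverse g)\<close>, and \<open>f * inverse g\<close> has a pole when
  \<open>e < d\<close>.\<close>

lemma zdeg_add_less:
  assumes f: "zdeg Q f d" and g: "zdeg Q g e" and "e < d"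
  shows "zdeg Q (f + g) d"
proof -
  have fg: "zdeg Q (f * inverse g) (d - e)" using zdeg_mult[OF f zdeg_inverse[OF g]] by simp
  then have "f * inverse g \<notin> Q" using zdeg_mem_iff \<open>e < d\<close> by simp
  then have "zdeg Q (1 + inverse (f * inverse g)) 0"
    by (intro zdeg_unit one_plus_inverse_unit[OF vr])
  from zdeg_mult[OF f this] show ?thesis
    using zdeg_nonzero[OF f] by (simp add: distrib_left flip: mult.assoc)
qed

lemma zdeg_z: "zdeg Q z 8"
  using place_units_one[OF vr] by (auto simp: zdeg_def intro!: bexI[of _ 1])

lemma zdeg_y: "zdeg Q y (2 * int m)"
proof -
  obtain u where u: "u \<in> place_units Q" "z ^ m = u * y ^ 4"
    using infinity_leading_factors(1) infinity_poles by blast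
  have "y ^ 8 = inverse u ^ 2 * z powi (2 * int m)"
  proof -
    have "z powi (2 * int m) = (z ^ m) ^ 2"
      by (metis mult.commute of_nat_mult of_nat_numeral power_int_of_nat power_mult)
    also have "\<dots> = u ^ 2 * y ^ 8" by (simp add: u(2) power_mult_distrib flip: power_mult)
    finally show ?thesis using u(1) by (auto simp: place_units_def field_simps)
  qed
  then show ?thesis unfolding zdeg_def
    using u(1) place_units_power[OF vr place_units_inverse[OF vr]] by blast
qed

text \<open>Cubing \<open>z ^ m = v * y ^ 4\<close> produces \<open>y ^ 12\<close>, the fourth power
  of \<open>y ^ 3 = u * x ^ 2\<close>, hence \<open>x ^ 8\<close> up to a unit.\<close>

lemma zdeg_x: "zdeg Q x (3 * int m)"
proof -
  obtain u where u: "u \<in> place_units Q" "y ^ 3 = u * x ^ 2"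
    using infinity_leading_factors(2) infinity_poles by blast
  obtain v where v: "v \<in> place_units Q" "z ^ m = v * y ^ 4"
    using infinity_leading_factors(1) infinity_poles by blast
  have "z powi (3 * int m) = (z ^ m) ^ 3"
    by (metis mult.commute of_nat_mult of_nat_numeral power_int_of_nat power_mult)
  also have "\<dots> = v ^ 3 * (y ^ 3) ^ 4" by (simp add: v(2) power_mult_distrib flip: power_mult)
  also have "\<dots> = v ^ 3 * u ^ 4 * x ^ 8" by (simp add: u(2) power_mult_distrib flip: power_mult)
  finally have "x ^ 8 = inverse (v ^ 3 * u ^ 4) * z powi (3 * int m)"
    using u(1) v(1) by (auto simp: place_units_def field_simps)
  moreover have "inverse (v ^ 3 * u ^ 4) \<in> place_units Q"
    using u(1) v(1) by (intro place_units_inverse[OF vr] place_units_mult[OF vr] place_units_power[OF vr])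
  ultimately show ?thesis unfolding zdeg_def by blast
qed

end

end

section \<open>The coordinate ring as a tower of quadratic extensions\<close>

definition quadratic_ext :: "'f::field set \<Rightarrow> 'f \<Rightarrow> 'f set" where
  "quadratic_ext S t = {a + b * t | a b. a \<in> S \<and> b \<in> S}"

lemma generator_mem_quadratic_ext:
  assumes "subring_set S"
  shows "t \<in> quadratic_ext S t"
proof -
  have "t = 0 + 1 * t" by simp
  then show ?thesis using subring_closed(1,4)[OF assms] unfolding quadratic_ext_def by blast
qed

lemma base_subset_quadratic_ext:
  assumes "subring_set S"
  shows "S \<subseteq> quadratic_ext S t"
proof
  fix a assume "a \<in> S"
  moreover have "a = a + 0 * t" by simp
  ultimately show "a \<in> quadratic_ext S t"
    using subring_closed(4)[OF assms] unfolding quadratic_ext_def by blast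
qed

text \<open>For \<open>h\<close> in a subring \<open>S\<close> this says that \<open>S\<close>
  modulo the multiples of \<open>h\<close> is reduced; for a nonzero polynomial it is
  square-freeness.\<close>

definition divides_root :: "'f::field set \<Rightarrow> 'f \<Rightarrow> bool" where
  "divides_root S h \<longleftrightarrow> (\<forall>s\<in>S. (\<exists>e\<in>S. s ^ 2 = h * e) \<longrightarrow> (\<exists>e\<in>S. s = h * e))"

text \<open>As \<open>k \<le> 2 ^ k\<close>, the exponent can be raised to a power of 2, after which
  square roots are extracted one at a time.\<close>

lemma divides_root_power:
  assumes S: "subring_set S" and h: "divides_root S h" "h \<in> S" "h \<noteq> 0"
    and s: "s \<in> S" "\<exists>e\<in>S. s ^ k = h * e" and "0 < k"
  shows "\<exists>e\<in>S. s = h * e"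
proof -
  have "\<exists>e\<in>S. s = h * e" if "s \<in> S" "\<exists>e\<in>S. s ^ (2 ^ j) = h * e" for j s
    using that
  proof (induction j arbitrary: s)
    case (Suc j)
    then have "\<exists>e\<in>S. (s ^ 2) ^ (2 ^ j) = h * e" by (simp flip: power_mult)
    with Suc have "\<exists>e\<in>S. s ^ 2 = h * e" by (simp add: subring_closed[OF S])
    with h(1) Suc.prems(1) show ?case by (auto simp: divides_root_def)
  qed simp
  moreover obtain e where e: "e \<in> S" "s ^ k = h * e" using s(2) by blast
  have "s ^ (2 ^ k) = s ^ k * s ^ (2 ^ k - k)"
    by (simp flip: power_add add: less_imp_le)
  then have "s ^ (2 ^ k) = h * (e * s ^ (2 ^ k - k))" using e(2) by simp
  moreover have "e * s ^ (2 ^ k - k) \<in> S" using e(1) s(1) by (intro subring_closed[OF S])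
  ultimately show ?thesis using s(1) by blast
qed

definition ggs_semigroup :: "nat \<Rightarrow> nat set" where
  "ggs_semigroup m = {3 * i * m + 2 * j * m + 8 * k | i j k. i \<le> 1 \<and> j \<le> 3}"

context GGS2_odd
begin

definition line_ring :: "'f set" where
  "line_ring = ring_adjoin K z"

text \<open>The invariant carried up the tower. One degree must serve all places at infinity at
  once, which will give uniqueness of that place. The multiplier \<open>b\<close> allows
  denominators to be moved into \<open>line_ring\<close>, and the last clause preserves
  square-freeness.\<close>

definition tower_ring :: "'f set \<Rightarrow> nat set \<Rightarrow> bool" where
  "tower_ring S D \<longleftrightarrow> subring_set S \<and> line_ring \<subseteq> S
     \<and> (\<forall>a\<in>S. a \<noteq> 0 \<longrightarrow> (\<exists>d\<in>D. \<forall>Q. point_at_infinity K x y z Q \<longrightarrow> zdeg Q a (int d)))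
     \<and> (\<forall>a\<in>S. a \<noteq> 0 \<longrightarrow> (\<exists>b\<in>S. a * b \<in> line_ring \<and> a * b \<noteq> 0))
     \<and> (\<forall>h\<in>line_ring. divides_root line_ring h \<longrightarrow> divides_root S h)"

text \<open>Horner induction: a nonzero \<open>z * poly p z\<close> has pole order at least 8 and
  outweighs the constant \<open>c\<close>.\<close>

lemma tower_ring_line_ring: "tower_ring line_ring (range (\<lambda>k. 8 * k))"
  unfolding tower_ring_def
proof (intro conjI ballI impI)
  show sub: "subring_set line_ring"
    unfolding line_ring_def by (rule subring_ring_adjoin[OF subring_K])
  fix a assume a: "a \<in> line_ring" "a \<noteq> 0"
  show "\<exists>b\<in>line_ring. a * b \<in> line_ring \<and> a * b \<noteq> 0"
    using a by (intro bexI[of _ 1]) (auto intro: subring_closed[OF sub])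
  from a(1) obtain p where p: "a = poly p z" "\<forall>i. coeff p i \<in> K"
    by (auto simp: line_ring_def ring_adjoin_def)
  show "\<exists>d\<in>range ((*) 8). \<forall>Q. point_at_infinity K x y z Q \<longrightarrow> zdeg Q a (int d)"
    using p a(2)
  proof (induction p arbitrary: a)
    case (pCons c p)
    have c: "c \<in> K" and coeffs: "\<forall>i. coeff p i \<in> K"
      using pCons.prems(2) by (metis coeff_pCons_0) (metis coeff_pCons_Suc pCons.prems(2))
    show ?case
    proof (cases "poly p z = 0")
      case True
      then have "a \<in> K" using c pCons.prems by simp
      then have "zdeg Q a (int (8 * 0))" if "point_at_infinity K x y z Q" for Q
        using zdeg_unit[OF that] K_units[OF infinity_place[OF that]] pCons.prems(3) by simp
      then show ?thesis by blast
    next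
      case False
      then obtain k where k: "\<And>Q. point_at_infinity K x y z Q \<Longrightarrow> zdeg Q (poly p z) (int (8 * k))"
        using pCons.IH[OF refl coeffs] by auto
      have "zdeg Q a (int (8 * Suc k))" if Q: "point_at_infinity K x y z Q" for Q
      proof -
        have zp: "zdeg Q (z * poly p z) (int (8 * Suc k))"
          using zdeg_mult[OF Q zdeg_z[OF Q] k[OF Q]] by simp
        show ?thesis
        proof (cases "c = 0")
          case False
          then have "zdeg Q c 0" using zdeg_unit[OF Q] K_units[OF infinity_place[OF Q]] c by blast
          then show ?thesis
            using zdeg_add_less[OF Q zp, of c 0] pCons.prems(1) by (simp add: add.commute)
        qed (use zp pCons.prems(1) in simp)
      qed
      then show ?thesis by blast
    qed
  qed simp
qed auto

text \<open>With \<open>w = y\<^sup>2 + y\<close> the equation of \<open>y\<close> splits into \<open>w\<^sup>2 + w = z\<^sup>m\<close> and \<open>y\<^sup>2 + y = w\<close>.\<close>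

definition coord_ring :: "'f set" where
  "coord_ring = quadratic_ext (quadratic_ext (quadratic_ext line_ring (y ^ 2 + y)) y) x"

context
  fixes P :: "'f set"
  assumes P: "point_at_infinity K x y z P"
begin

text \<open>By \<open>disjoint\<close>, \<open>a\<close> and \<open>b * t\<close> never have equal
  pole orders, so their sum takes the larger one and vanishes only for \<open>a = b = 0\<close>. The
  norm and divisibility arguments rest on this independence of 1 and \<open>t\<close>.\<close>

lemma tower_ring_quadratic_ext:
  assumes S: "tower_ring S D"
    and t: "t ^ 2 + t \<in> S"
    and deg_t: "\<And>Q. point_at_infinity K x y z Q \<Longrightarrow> zdeg Q t (int e)"
    and disjoint: "\<And>d d'. d \<in> D \<Longrightarrow> d' \<in> D \<Longrightarrow> d \<noteq> d' + e"
    and D': "\<And>d. d \<in> D \<Longrightarrow> d \<in> D' \<and> d + e \<in> D'"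
  shows "tower_ring (quadratic_ext S t) D'"
proof -
  have sub: "subring_set S" and base: "line_ring \<subseteq> S"
    and deg: "\<And>a. a \<in> S \<Longrightarrow> a \<noteq> 0 \<Longrightarrow>
      \<exists>d\<in>D. \<forall>Q. point_at_infinity K x y z Q \<longrightarrow> zdeg Q a (int d)"
    and norm: "\<And>a. a \<in> S \<Longrightarrow> a \<noteq> 0 \<Longrightarrow> \<exists>b\<in>S. a * b \<in> line_ring \<and> a * b \<noteq> 0"
    and root: "\<And>h. h \<in> line_ring \<Longrightarrow> divides_root line_ring h \<Longrightarrow> divides_root S h"
    using S by (auto simp: tower_ring_def)
  note closed = subring_closed[OF sub]
  define c where "c = t ^ 2 + t"
  have cS: "c \<in> S" using t by (simp add: c_def)
  have t2: "t * t = c + t"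
    using add_self[of t] by (simp add: c_def power2_eq_square add.assoc)
  have S_sub: "a \<in> quadratic_ext S t" if "a \<in> S" for a
    unfolding quadratic_ext_def using that closed(4) by force
  have sum_deg: "\<exists>d\<in>D'. \<forall>Q. point_at_infinity K x y z Q \<longrightarrow> zdeg Q (a + b * t) (int d)"
    if a: "a \<in> S" and b: "b \<in> S" and ne: "a \<noteq> 0 \<or> b \<noteq> 0" for a b
  proof (cases "b = 0")
    case True
    then show ?thesis using deg[OF a] ne D' by auto
  next
    case False
    then obtain d where d: "d \<in> D" "\<And>Q. point_at_infinity K x y z Q \<Longrightarrow> zdeg Q b (int d)"
      using deg[OF b] by blast
    have bt: "zdeg Q (b * t) (int (d + e))" if "point_at_infinity K x y z Q" for Q
      using zdeg_mult[OF that d(2) deg_t] that by simp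
    show ?thesis
    proof (cases "a = 0")
      case True
      then have "zdeg Q (a + b * t) (int (d + e))" if "point_at_infinity K x y z Q" for Q
        using bt[OF that] by simp
      then show ?thesis using d(1) D' by blast
    next
      case False
      then obtain d' where d': "d' \<in> D" "\<And>Q. point_at_infinity K x y z Q \<Longrightarrow> zdeg Q a (int d')"
        using deg[OF a] by blast
      have "d' \<noteq> d + e" using disjoint d d' by blast
      then consider "d' < d + e" | "d + e < d'" by linarith
      then show ?thesis
      proof cases
        case 1
        then have "zdeg Q (a + b * t) (int (d + e))" if "point_at_infinity K x y z Q" for Q
          using zdeg_add_less[OF that bt d'(2)] that by (simp add: add.commute)
        then show ?thesis using D' d by blast
      next
        case 2
        then have "zdeg Q (a + b * t) (int d')" if "point_at_infinity K x y z Q" for Q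
          using zdeg_add_less[OF that d'(2) bt] that by simp
        then show ?thesis using D' d' by blast
      qed
    qed
  qed
  \<comment> \<open>The place \<open>P\<close> enters here: an element that has a degree at some
    place at infinity is nonzero.\<close>
  have indep: "a = 0 \<and> b = 0" if "a \<in> S" "b \<in> S" "a + b * t = 0" for a b
    using sum_deg[OF that(1,2)] that(3) zdeg_nonzero[OF P] P by metis
  have prod: "(a + b * t) * (a' + b' * t) = (a * a' + b * b' * c) + (a * b' + b * a' + b * b') * t"
    for a b a' b'
  proof -
    have "(a + b * t) * (a' + b' * t) = a * a' + (a * b' + b * a') * t + b * b' * (t * t)"
      by (simp add: algebra_simps)
    then show ?thesis unfolding t2 by (simp add: algebra_simps)
  qed
  have sub': "subring_set (quadratic_ext S t)"
    unfolding subring_set_def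
  proof (intro conjI ballI)
    show "1 \<in> quadratic_ext S t" by (intro S_sub closed)
    fix f g assume "f \<in> quadratic_ext S t" "g \<in> quadratic_ext S t"
    then obtain a b a' b' where ab: "a \<in> S" "b \<in> S" "a' \<in> S" "b' \<in> S"
      and fg: "f = a + b * t" "g = a' + b' * t"
      by (auto simp: quadratic_ext_def)
    have "f - g = (a - a') + (b - b') * t" by (simp add: fg algebra_simps)
    then show "f - g \<in> quadratic_ext S t" using ab by (auto simp: quadratic_ext_def intro!: closed)
    show "f * g \<in> quadratic_ext S t" unfolding fg prod quadratic_ext_def
      using ab cS by (blast intro: closed)
  qed
  show ?thesis unfolding tower_ring_def
  proof (intro conjI ballI impI)
    show "subring_set (quadratic_ext S t)" by (rule sub')
    show "line_ring \<subseteq> quadratic_ext S t" using base S_sub by blast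
  next
    fix f assume "f \<in> quadratic_ext S t" "f \<noteq> 0"
    then obtain a b where ab: "a \<in> S" "b \<in> S" and f: "f = a + b * t"
      by (auto simp: quadratic_ext_def)
    with \<open>f \<noteq> 0\<close> have ne: "a \<noteq> 0 \<or> b \<noteq> 0" by auto
    show "\<exists>d\<in>D'. \<forall>Q. point_at_infinity K x y z Q \<longrightarrow> zdeg Q f (int d)"
      unfolding f using sum_deg ab ne by blast
    \<comment> \<open>\<open>N\<close> is the norm of \<open>f\<close>; the conjugate
      \<open>(a + b) + b * t\<close> arises from replacing \<open>t\<close> by
      \<open>t + 1\<close>.\<close>
    define N where "N = (a + b) * a + b * b * c"
    have NS: "N \<in> S" unfolding N_def using ab cS by (intro closed)
    have "f * ((a + b) + b * t) = (a * (a + b) + b * b * c) + (b * a + b * a + (b * b + b * b)) * t"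
      unfolding f prod by (simp add: algebra_simps)
    then have fN: "f * ((a + b) + b * t) = N"
      by (simp only: add_self N_def) (simp add: mult.commute)
    have "(a + b) + b * t \<noteq> 0"
    proof
      assume "(a + b) + b * t = 0"
      then have "a + b = 0 \<and> b = 0" using indep ab closed(6) by blast
      then have "a = 0 \<and> b = 0" by (metis add.right_neutral)
      with ne show False by auto
    qed
    with fN \<open>f \<noteq> 0\<close> have "N \<noteq> 0" by auto
    then obtain b' where b': "b' \<in> S" "N * b' \<in> line_ring" "N * b' \<noteq> 0" using norm NS by blast
    have "(a + b) + b * t \<in> quadratic_ext S t"
      unfolding quadratic_ext_def using ab closed(6) by blast
    then have "((a + b) + b * t) * b' \<in> quadratic_ext S t"
      using S_sub[OF b'(1)] by (rule subring_mult[OF sub'])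
    moreover have "f * (((a + b) + b * t) * b') = N * b'" by (simp flip: fN add: mult.assoc)
    ultimately show "\<exists>b\<in>quadratic_ext S t. f * b \<in> line_ring \<and> f * b \<noteq> 0"
      using b' by metis
  next
    fix h assume h: "h \<in> line_ring" "divides_root line_ring h"
    then have hS: "h \<in> S" using base by blast
    show "divides_root (quadratic_ext S t) h" unfolding divides_root_def
    proof (intro ballI impI)
      fix s assume "s \<in> quadratic_ext S t" "\<exists>e\<in>quadratic_ext S t. s ^ 2 = h * e"
      then obtain a b p q where ab: "a \<in> S" "b \<in> S" "p \<in> S" "q \<in> S"
        and s: "s = a + b * t" and sq: "s * s = h * (p + q * t)"
        by (auto simp: quadratic_ext_def power2_eq_square)
      have "s * s = (a * a + b * b * c) + ((a * b + a * b) + b * b) * t"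
        unfolding s prod by (simp add: algebra_simps)
      \<comment> \<open>In characteristic 2 the cross terms cancel and \<open>t\<close> has
        coefficient \<open>b * b\<close>. So \<open>h\<close> divides \<open>b ^ 2\<close>, and from
        this it divides \<open>a ^ 2\<close>.\<close>
      then have "s * s = (a * a + b * b * c) + b * b * t" by (simp only: add_self add_0)
      then have "(a * a + b * b * c - h * p) + (b * b - h * q) * t = 0"
        using sq by (simp add: algebra_simps)
      then have "a * a + b * b * c - h * p = 0 \<and> b * b - h * q = 0"
        using ab cS hS by (intro indep closed)
      then have "b ^ 2 = h * q" "a ^ 2 = h * (p - q * c)"
        by algebra+
      moreover have "p - q * c \<in> S" using ab cS by (intro closed)
      ultimately obtain a' b' where "a' \<in> S" "a = h * a'" "b' \<in> S" "b = h * b'"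
        using root[OF h] ab unfolding divides_root_def by metis
      then have "s = h * (a' + b' * t) \<and> a' + b' * t \<in> quadratic_ext S t"
        by (auto simp: s quadratic_ext_def algebra_simps)
      then show "\<exists>e\<in>quadratic_ext S t. s = h * e" by blast
    qed
  qed
qed

text \<open>The orders never collide: over \<open>line_ring\<close> they are multiples of 8 while
  \<open>4 * m\<close> is not, then multiples of 4 while \<open>2 * m\<close> is not, then even
  while \<open>3 * m\<close> is odd.\<close>

lemma tower_ring_coord_ring: "tower_ring coord_ring (ggs_semigroup m)"
  and generators_mem_coord_ring: "x \<in> coord_ring" "y \<in> coord_ring" "z \<in> coord_ring" "K \<subseteq> coord_ring"
proof -
  define w where "w = y ^ 2 + y"
  define R1 where "R1 = quadratic_ext line_ring w"
  define R2 where "R2 = quadratic_ext R1 y"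
  have zK: "z \<in> line_ring" "K \<subseteq> line_ring"
    using ring_adjoin_base[OF subring_K] ring_adjoin_generator[OF subring_K]
    by (auto simp: line_ring_def)
  note T0 = tower_ring_line_ring
  have s0: "subring_set line_ring" using T0 by (simp add: tower_ring_def)
  have deg_w: "zdeg Q w (int (4 * m))" if Q: "point_at_infinity K x y z Q" for Q
    using zdeg_add_less[OF Q zdeg_power[OF Q zdeg_y[OF Q], of 2] zdeg_y[OF Q]] m_pos
    by (simp add: w_def)
  have "w ^ 2 + w = y ^ 4 + (2 * (y ^ 3 + y ^ 2) + y)"
    unfolding w_def by algebra
  then have "w ^ 2 + w = z ^ m"
    unfolding curve2[symmetric] two_eq_0 using minus_eq[of y] by (simp add: diff_conv_add_uminus del: add_uminus_conv_diff)
  then have wR: "w ^ 2 + w \<in> line_ring" using zK subring_closed[OF s0] by simp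
  have T1: "tower_ring R1 {4 * i * m + 8 * k | i k. i \<le> 1}" unfolding R1_def
  proof (rule tower_ring_quadratic_ext[OF T0 wR deg_w])
    fix d d' assume "d \<in> range ((*) (8 :: nat))" "d' \<in> range ((*) (8 :: nat))"
    then show "d \<noteq> d' + 4 * m" using m_mod_8 by (auto; presburger)
  next
    fix d assume "d \<in> range ((*) (8 :: nat))"
    then obtain k where "d = 4 * 0 * m + 8 * k" "d + 4 * m = 4 * 1 * m + 8 * k" by auto
    then show "d \<in> {4 * i * m + 8 * k | i k. i \<le> 1} \<and> d + 4 * m \<in> {4 * i * m + 8 * k | i k. i \<le> 1}"
      by (metis (mono_tags, lifting) mem_Collect_eq zero_le order_refl)
  qed
  have s1: "subring_set R1" using T1 by (simp add: tower_ring_def)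
  have wR1: "w \<in> R1" unfolding R1_def by (rule generator_mem_quadratic_ext[OF s0])
  have T2: "tower_ring R2 {2 * j * m + 8 * k | j k. j \<le> 3}" unfolding R2_def
  proof (rule tower_ring_quadratic_ext[OF T1])
    show "y ^ 2 + y \<in> R1" using wR1 by (simp add: w_def)
    show "zdeg Q y (int (2 * m))" if "point_at_infinity K x y z Q" for Q
      using zdeg_y[OF that] by simp
  next
    fix d d' assume d: "d \<in> {4 * i * m + 8 * k | i k. i \<le> 1}" "d' \<in> {4 * i * m + 8 * k | i k. i \<le> 1}"
    then have "4 dvd d" "4 dvd d'" by auto
    then show "d \<noteq> d' + 2 * m" using m_mod_8 by presburger
  next
    fix d assume "d \<in> {4 * i * m + 8 * k | i k. i \<le> 1}"
    then obtain i k where "d = 2 * (2 * i) * m + 8 * k" "d + 2 * m = 2 * (2 * i + 1) * m + 8 * k"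
      "2 * i \<le> 3" "2 * i + 1 \<le> 3"
      by (auto simp: algebra_simps)
    then show "d \<in> {2 * j * m + 8 * k | j k. j \<le> 3} \<and> d + 2 * m \<in> {2 * j * m + 8 * k | j k. j \<le> 3}"
      by (metis (mono_tags, lifting) mem_Collect_eq)
  qed
  have s2: "subring_set R2" using T2 by (simp add: tower_ring_def)
  have yR2: "y \<in> R2" unfolding R2_def by (rule generator_mem_quadratic_ext[OF s1])
  have A: "coord_ring = quadratic_ext R2 x" by (simp add: coord_ring_def R2_def R1_def w_def)
  show "tower_ring coord_ring (ggs_semigroup m)" unfolding A
  proof (rule tower_ring_quadratic_ext[OF T2])
    show "x ^ 2 + x \<in> R2" using yR2 subring_closed[OF s2] by (simp add: curve1)
    show "zdeg Q x (int (3 * m))" if "point_at_infinity K x y z Q" for Q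
      using zdeg_x[OF that] by simp
  next
    fix d d' assume d: "d \<in> {2 * j * m + 8 * k | j k. j \<le> 3}" "d' \<in> {2 * j * m + 8 * k | j k. j \<le> 3}"
    then have "2 dvd d" "2 dvd d'" by auto
    then show "d \<noteq> d' + 3 * m" using m_mod_8 by presburger
  next
    fix d assume "d \<in> {2 * j * m + 8 * k | j k. j \<le> 3}"
    then obtain j k where "d = 3 * 0 * m + 2 * j * m + 8 * k" "d + 3 * m = 3 * 1 * m + 2 * j * m + 8 * k" "j \<le> 3"
      by (auto simp: algebra_simps)
    then show "d \<in> ggs_semigroup m \<and> d + 3 * m \<in> ggs_semigroup m" unfolding ggs_semigroup_def
      by (metis (mono_tags, lifting) mem_Collect_eq zero_le order_refl)
  qed
  have "line_ring \<subseteq> R2" "R2 \<subseteq> coord_ring"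
    using T2 base_subset_quadratic_ext[OF s2] by (auto simp: tower_ring_def A)
  then show "x \<in> coord_ring" "y \<in> coord_ring" "z \<in> coord_ring" "K \<subseteq> coord_ring"
    using zK yR2 generator_mem_quadratic_ext[OF s2, of x] by (auto simp: A)
qed

end

end

section \<open>The Weierstrass semigroup at infinity\<close>

text \<open>Long division, one coefficient at a time: \<open>pCons a r\<close> has degree at most
  \<open>degree q\<close>, and subtracting \<open>smult c q\<close> removes the top coefficient. The
  digit \<open>c\<close> stays in \<open>K\<close> because \<open>K\<close> is closed under
  inverses.\<close>

lemma subfield_poly_division:
  assumes K: "subfield_set K" and q: "\<And>i. coeff q i \<in> K" "q \<noteq> 0" and p: "\<And>i. coeff p i \<in> K"
  shows "\<exists>s r. (\<forall>i. coeff s i \<in> K) \<and> (\<forall>i. coeff r i \<in> K) \<and> p = s * q + r \<and> (r = 0 \<or> degree r < degree q)"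
  using p
proof (induction p)
  case 0
  have "coeff 0 i \<in> K" for i using 0 by simp
  then show ?case by (intro exI[of _ 0]) simp
next
  case (pCons a p)
  have sub: "subring_set K" using K by (simp add: subfield_set_def subring_set_def)
  note closed = subring_closed[OF sub]
  have a: "a \<in> K" using pCons.prems[of 0] by simp
  have "coeff p i \<in> K" for i using pCons.prems[of "Suc i"] by simp
  then obtain s r where sr: "\<And>i. coeff s i \<in> K" "\<And>i. coeff r i \<in> K" "p = s * q + r"
    "r = 0 \<or> degree r < degree q"
    using pCons.IH by blast
  define r' where "r' = pCons a r"
  define c where "c = coeff r' (degree q) * inverse (lead_coeff q)"
  have r': "coeff r' i \<in> K" for i
    unfolding r'_def using a sr(2) by (rule coeffs_pCons_closed[OF sub])
  have "degree r' \<le> degree q"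
    using sr(4) degree_pCons_le[of a r] by (auto simp: r'_def)
  then have "degree (r' - smult c q) \<le> degree q"
    by (intro degree_diff_le) (auto intro: le_trans[OF degree_smult_le])
  moreover have "coeff (r' - smult c q) (degree q) = 0" using q(2) by (simp add: c_def)
  ultimately have "r' - smult c q = 0 \<or> degree (r' - smult c q) < degree q"
    by (rule eq_zero_or_degree_less)
  moreover have c: "c \<in> K" using K r' q(1) by (auto simp: c_def subfield_set_def)
  have "coeff (r' - smult c q) i \<in> K" for i using c r' q(1) by (auto intro!: closed)
  moreover have "coeff (pCons c s) i \<in> K" for i using c sr(1) by (rule coeffs_pCons_closed[OF sub])
  moreover have "pCons a p = pCons c s * q + (r' - smult c q)"
    by (simp add: sr(3) r'_def)
  ultimately show ?case by blast
qed

context GGS2_odd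
begin

context
  fixes P :: "'f set"
  assumes P: "point_at_infinity K x y z P"
begin

section \<open>Fractions of the coordinate ring and uniqueness of the place at infinity\<close>

lemma subring_coord_ring: "subring_set coord_ring"
  and line_ring_subset: "line_ring \<subseteq> coord_ring"
  and coord_ring_zdeg: "a \<in> coord_ring \<Longrightarrow> a \<noteq> 0 \<Longrightarrow>
    \<exists>d\<in>ggs_semigroup m. \<forall>Q. point_at_infinity K x y z Q \<longrightarrow> zdeg Q a (int d)"
  and coord_ring_norm: "a \<in> coord_ring \<Longrightarrow> a \<noteq> 0 \<Longrightarrow> \<exists>b\<in>coord_ring. a * b \<in> line_ring \<and> a * b \<noteq> 0"
  and coord_ring_divides_root: "h \<in> line_ring \<Longrightarrow> divides_root line_ring h \<Longrightarrow> divides_root coord_ring h"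
  using tower_ring_coord_ring[OF P] by (auto simp: tower_ring_def)

private lemmas coord_closed = subring_closed[OF subring_coord_ring]

lemma fraction_of_coord_ring: "\<exists>a\<in>coord_ring. \<exists>b\<in>coord_ring. b \<noteq> 0 \<and> f = a * inverse b"
proof -
  define L where "L = {a * inverse b | a b. a \<in> coord_ring \<and> b \<in> coord_ring \<and> b \<noteq> 0}"
  have L_I: "f \<in> L" if "a \<in> coord_ring" "b \<in> coord_ring" "b \<noteq> 0" "f = a * inverse b" for f a b
    unfolding L_def using that by blast
  have in_L: "a \<in> L" if "a \<in> coord_ring" for a
    using that coord_closed(1) by (rule L_I) auto
  have "subfield_set L" unfolding subfield_set_def
  proof (intro conjI ballI)
    show "1 \<in> L" by (intro in_L coord_closed)
    fix f g assume "f \<in> L" "g \<in> L"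
    then obtain a b c d where ab: "a \<in> coord_ring" "b \<in> coord_ring" "b \<noteq> 0" "f = a * inverse b"
      and cd: "c \<in> coord_ring" "d \<in> coord_ring" "d \<noteq> 0" "g = c * inverse d"
      by (auto simp: L_def)
    show "f - g \<in> L"
      using ab cd by (intro L_I[of "a * d - c * b" "b * d"]) (auto simp: field_simps intro!: coord_closed)
    show "f * g \<in> L"
      using ab cd by (intro L_I[of "a * c" "b * d"]) (auto simp: field_simps intro!: coord_closed)
  next
    fix f assume "f \<in> L"
    then obtain a b where ab: "a \<in> coord_ring" "b \<in> coord_ring" "b \<noteq> 0" "f = a * inverse b"
      by (auto simp: L_def)
    show "inverse f \<in> L"
    proof (cases "a = 0")
      case True
      then show ?thesis using ab in_L coord_closed(4) by simp
    next
      case False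
      then have "inverse f = b * inverse a" using ab by simp
      then show ?thesis using ab False by (intro L_I[of b a]) auto
    qed
  qed
  moreover have "K \<union> {x, y, z} \<subseteq> L" using generators_mem_coord_ring[OF P] in_L by auto
  ultimately have "adjoin K {x, y, z} \<subseteq> L" by (auto simp: adjoin_def)
  then have "f \<in> L" using generated by auto
  then show ?thesis by (auto simp: L_def)
qed

lemma zdeg_exists:
  assumes "f \<noteq> 0"
  shows "\<exists>d. \<forall>Q. point_at_infinity K x y z Q \<longrightarrow> zdeg Q f d"
proof -
  obtain a b where ab: "a \<in> coord_ring" "b \<in> coord_ring" "b \<noteq> 0" "f = a * inverse b"
    using fraction_of_coord_ring by blast
  with assms have "a \<noteq> 0" by auto
  with ab coord_ring_zdeg obtain d e where
    "\<And>Q. point_at_infinity K x y z Q \<Longrightarrow> zdeg Q a (int d)"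
    "\<And>Q. point_at_infinity K x y z Q \<Longrightarrow> zdeg Q b (int e)" by metis
  then show ?thesis unfolding ab(4) using zdeg_mult zdeg_inverse by blast
qed

text \<open>Membership in a place at infinity is decided by the sign of a degree that is the same at
  all such places.\<close>

lemma point_at_infinity_unique:
  assumes Q: "point_at_infinity K x y z Q"
  shows "Q = P"
proof -
  have "f \<in> Q \<longleftrightarrow> f \<in> P" for f
  proof (cases "f = 0")
    case True
    then show ?thesis
      using P Q subring_zero valuation_ring_subring infinity_valuation_ring by metis
  next
    case False
    then show ?thesis using zdeg_exists zdeg_mem_iff P Q by metis
  qed
  then show ?thesis by blast
qed

section \<open>Functions with poles only at infinity\<close>

definition regular_outside :: "'f set" where
  "regular_outside = {f. \<forall>Q\<in>places K. Q \<noteq> P \<longrightarrow> f \<in> Q}"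

lemma subring_regular_outside: "subring_set regular_outside"
  using subring_closed[OF valuation_ring_subring[OF place_valuation_ring]]
  by (auto simp: subring_set_def regular_outside_def)

lemma coord_ring_subset_regular: "coord_ring \<subseteq> regular_outside"
proof
  fix a assume a: "a \<in> coord_ring"
  show "a \<in> regular_outside" unfolding regular_outside_def
  proof (intro CollectI ballI impI)
    fix Q assume Q: "Q \<in> places K" "Q \<noteq> P"
    note Q_sub = valuation_ring_subring[OF place_valuation_ring[OF Q(1)]]
    have xyz: "x \<in> Q" "y \<in> Q" "z \<in> Q"
      using point_at_infinity_unique Q by (auto simp: point_at_infinity_def)
    have "K \<subseteq> Q" using Q(1) by (auto simp: places_def)
    then have "line_ring \<subseteq> Q"
      unfolding line_ring_def using xyz by (intro ring_adjoin_least[OF Q_sub])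
    moreover have "quadratic_ext S t \<subseteq> Q" if "S \<subseteq> Q" "t \<in> Q" for S t
      using that by (auto simp: quadratic_ext_def intro!: subring_closed[OF Q_sub])
    ultimately have "coord_ring \<subseteq> Q"
      unfolding coord_ring_def using xyz by (simp add: subring_closed[OF Q_sub])
    then show "a \<in> Q" using a by blast
  qed
qed

text \<open>If \<open>f\<close> were not integral, some valuation ring containing
  \<open>coord_ring\<close> would miss it, and this would be a place other than
  \<open>P\<close>.\<close>

lemma regular_integral:
  assumes f: "f \<in> regular_outside"
  shows "f \<in> ring_adjoin coord_ring (inverse f)"
proof (rule ccontr)
  assume "f \<notin> ring_adjoin coord_ring (inverse f)"
  then obtain V where V: "valuation_ring_set V" "coord_ring \<subseteq> V" "f \<notin> V"
    using valuation_ring_avoiding_exists[OF subring_coord_ring] by blast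
  have "z \<in> V" "K \<subseteq> V" using V(2) generators_mem_coord_ring[OF P] by auto
  \<comment> \<open>This shows both that \<open>z\<close> is not in \<open>K\<close>, so that
    \<open>K\<close> is properly contained in \<open>V\<close>, and that \<open>V\<close> differs
    from \<open>P\<close>.\<close>
  moreover have "z \<notin> P" "K \<subseteq> P"
    using infinity_poles[OF P] P by (auto simp: point_at_infinity_def places_def)
  ultimately have "V \<in> places K" "V \<noteq> P"
    using V by (auto simp: places_def valuation_ring_set_def subring_set_def)
  with f V(3) show False by (auto simp: regular_outside_def)
qed

text \<open>Among all denominators of functions in \<open>regular_outside - coord_ring\<close> take one, \<open>h\<close>, of least
  degree. Minimality makes \<open>h\<close> square-free, in the sense of \<^const>\<open>divides_root\<close>, and this
  property is inherited by the coordinate ring because the extensions in the tower are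
  Artin-Schreier extensions with everywhere nonvanishing derivative. On the other hand
  integrality of \<open>g\<close> makes a power of \<open>h g\<close> divisible by \<open>h\<close>.\<close>

lemma regular_subset_coord_ring: "regular_outside \<subseteq> coord_ring"
proof (rule ccontr)
  assume "\<not> regular_outside \<subseteq> coord_ring"
  then obtain f where f: "f \<in> regular_outside" "f \<notin> coord_ring" by blast
  define bad where "bad p \<longleftrightarrow> (\<forall>i. coeff p i \<in> K) \<and> poly p z \<noteq> 0
    \<and> (\<exists>g\<in>regular_outside - coord_ring. poly p z * g \<in> coord_ring)" for p
  have "\<exists>p. bad p"
  proof -
    obtain a b where ab: "a \<in> coord_ring" "b \<in> coord_ring" "b \<noteq> 0" "f = a * inverse b"
      using fraction_of_coord_ring by blast
    \<comment> \<open>Multiplication by \<open>c\<close> puts the denominator into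
      \<open>line_ring\<close>, where polynomial degrees are available.\<close>
    then obtain c where c: "c \<in> coord_ring" "b * c \<in> line_ring" "b * c \<noteq> 0"
      using coord_ring_norm by blast
    then obtain p where "\<forall>i. coeff p i \<in> K" "b * c = poly p z"
      by (auto simp: line_ring_def ring_adjoin_def)
    moreover have "b * c * f = a * c" using ab by (simp add: field_simps)
    then have "b * c * f \<in> coord_ring" using ab(1) c(1) coord_closed(3) by metis
    ultimately have "bad p" using f c(3) by (auto simp: bad_def)
    then show ?thesis ..
  qed
  then obtain p where "bad p" and minimal: "\<And>q. bad q \<Longrightarrow> degree p \<le> degree q"
    using ex_has_least_nat[of bad _ degree] by blast
  then obtain g where g: "g \<in> regular_outside" "g \<notin> coord_ring" "poly p z * g \<in> coord_ring"
    and p: "\<forall>i. coeff p i \<in> K" "poly p z \<noteq> 0"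
    by (auto simp: bad_def)
  define h where "h = poly p z"
  have hR: "h \<in> line_ring" and h0: "h \<noteq> 0" using p by (auto simp: h_def line_ring_def ring_adjoin_def)
  have hA: "h \<in> coord_ring" using hR line_ring_subset by blast
  have R: "subring_set line_ring" unfolding line_ring_def by (rule subring_ring_adjoin[OF subring_K])
  have "divides_root line_ring h" unfolding divides_root_def
  proof (intro ballI impI)
    fix c assume c: "c \<in> line_ring" and "\<exists>e\<in>line_ring. c ^ 2 = h * e"
    then obtain e where e: "e \<in> line_ring" "c ^ 2 = h * e" by blast
    obtain q where q: "c = poly q z" "\<forall>i. coeff q i \<in> K"
      using c by (auto simp: line_ring_def ring_adjoin_def)
    have "p \<noteq> 0" using p by auto
    then obtain s r where sr: "\<forall>i. coeff s i \<in> K" "\<forall>i. coeff r i \<in> K" "q = s * p + r"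
      "r = 0 \<or> degree r < degree p"
      using subfield_poly_division[OF subfield_K, of p q] p q by blast
    define \<sigma> where "\<sigma> = poly s z"
    define \<rho> where "\<rho> = poly r z"
    have mem: "\<sigma> \<in> line_ring" "\<rho> \<in> line_ring"
      using sr by (auto simp: \<sigma>_def \<rho>_def line_ring_def ring_adjoin_def)
    have c_eq: "c = h * \<sigma> + \<rho>" by (simp add: q sr(3) h_def \<sigma>_def \<rho>_def)
    show "\<exists>e\<in>line_ring. c = h * e"
    proof (cases "\<rho> = 0")
      case True
      then show ?thesis using c_eq mem by auto
    next
      case False
      then have deg_r: "degree r < degree p" using sr(4) by (auto simp: \<rho>_def)
      \<comment> \<open>From \<open>\<rho> = c - h * \<sigma>\<close>: \<open>h\<close> divides
        \<open>\<rho> ^ 2\<close>, and \<open>e'\<close> is the quotient.\<close>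
      define e' where "e' = e - 2 * \<sigma> * c + h * \<sigma> ^ 2"
      have "\<rho> ^ 2 = c ^ 2 - h * (2 * \<sigma> * c) + h * (h * \<sigma> ^ 2)"
        using c_eq by algebra
      then have \<rho>2: "\<rho> ^ 2 = h * e'" unfolding e e'_def by (simp add: algebra_simps)
      have "(2 :: 'f) \<in> line_ring" using two_eq_0 subring_zero[OF R] by simp
      then have "e' \<in> line_ring"
        unfolding e'_def using e mem c hR by (intro subring_closed[OF R])
      then have "e' * (h * g) \<in> coord_ring"
        using g(3) line_ring_subset by (auto simp: h_def intro!: coord_closed)
      moreover have "\<rho> * (\<rho> * g) = e' * (h * g)" using \<rho>2 by (simp add: power2_eq_square)
      moreover have "\<rho> * g \<in> regular_outside"
        using mem g(1) line_ring_subset coord_ring_subset_regular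
        by (intro subring_mult[OF subring_regular_outside]) auto
      \<comment> \<open>If \<open>\<rho> * g\<close> is in \<open>coord_ring\<close> take
        \<open>g\<close>, otherwise \<open>\<rho> * g\<close> itself. Either way \<open>r\<close> is
        an admissible denominator of smaller degree than \<open>p\<close>.\<close>
      ultimately have "\<exists>g\<in>regular_outside - coord_ring. \<rho> * g \<in> coord_ring"
        using g(1,2) by (metis DiffI)
      then have "bad r" using sr(2) False by (simp add: bad_def \<rho>_def)
      with minimal deg_r show ?thesis by fastforce
    qed
  qed
  then have root: "divides_root coord_ring h" by (rule coord_ring_divides_root[OF hR])
  obtain d where "g \<in> poly_values coord_ring (inverse g) d"
    using regular_integral[OF g(1)] by (auto simp: ring_adjoin_eq_poly_values)
  then obtain c where c: "\<And>i. c i \<in> coord_ring" "g = (\<Sum>i\<le>d. c i * inverse g ^ i)"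
    using poly_values_expand by blast
  have g0: "g \<noteq> 0" using g(2) coord_closed(4) by auto
  \<comment> \<open>The integral equation of \<open>g\<close> is multiplied by
    \<open>h ^ Suc d * g ^ d\<close>; every term keeps a factor \<open>h\<close> next to powers of
    \<open>h\<close> and \<open>h * g\<close>.\<close>
  have "(h * g) ^ Suc d = h ^ Suc d * g ^ d * g" by (simp add: power_mult_distrib mult_ac)
  also have "\<dots> = (\<Sum>i\<le>d. h ^ Suc d * g ^ d * (c i * inverse g ^ i))"
    by (subst (2) c(2)) (rule sum_distrib_left)
  also have "\<dots> = (\<Sum>i\<le>d. h * (c i * h ^ i * (h * g) ^ (d - i)))"
  proof (intro sum.cong refl)
    fix i assume "i \<in> {..d}"
    then obtain j where "d = i + j" by (auto simp: le_iff_add)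
    then show "h ^ Suc d * g ^ d * (c i * inverse g ^ i) = h * (c i * h ^ i * (h * g) ^ (d - i))"
      using g0 by (simp add: power_add power_mult_distrib field_simps)
  qed
  finally have "(h * g) ^ Suc d = h * (\<Sum>i\<le>d. c i * h ^ i * (h * g) ^ (d - i))"
    by (simp add: sum_distrib_left)
  moreover have "(\<Sum>i\<le>d. c i * h ^ i * (h * g) ^ (d - i)) \<in> coord_ring"
    using coord_closed(3)[OF coord_closed(3)[OF c(1) coord_closed(7)[OF hA]] coord_closed(7)[OF g(3)]]
    by (intro coord_closed(8)) (simp add: h_def)
  ultimately have "\<exists>e\<in>coord_ring. (h * g) ^ Suc d = h * e" by blast
  then obtain e where "e \<in> coord_ring" "h * g = h * e"
    using divides_root_power[OF subring_coord_ring root hA h0, of "h * g" "Suc d"] g(3)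
    unfolding h_def by blast
  with h0 g(2) show False by auto
qed

section \<open>Uniformizers and the normalized valuation at infinity\<close>

lemma zdeg_uniformizer: "zdeg P (z ^ 2 ^ (n - 3) * inverse x) (- 1)"
proof -
  obtain j where "n = 3 + j" using n_ge by (auto simp: le_iff_add)
  \<comment> \<open>The order of \<open>x\<close> is one more than a multiple of the order 8 of
    \<open>z\<close>; this excess produces a simple zero.\<close>
  then have "3 * m = 8 * 2 ^ (n - 3) + 1" using three_m by (simp add: power_add)
  then have "int (2 ^ (n - 3)) * 8 + - (3 * int m) = - 1" by linarith
  then show ?thesis
    using zdeg_mult[OF P zdeg_power[OF P zdeg_z[OF P]] zdeg_inverse[OF P zdeg_x[OF P]]] by metis
qed

lemma uniformizer_iff: "uniformizer P t \<longleftrightarrow> zdeg P t (- 1)"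
proof
  have zP: "0 \<in> P" "0 \<notin> place_units P"
    using subring_zero[OF valuation_ring_subring[OF infinity_valuation_ring[OF P]]]
    by (auto simp: place_units_def)
  {
    assume t: "zdeg P t (- 1)"
    note t0 = zdeg_nonzero[OF P t]
    have "f \<in> P - place_units P \<longleftrightarrow> f \<in> (\<lambda>a. t * a) ` P" for f
    proof (cases "f = 0")
      case True
      then show ?thesis using zP by force
    next
      case False
      then obtain d where d: "zdeg P f d" using zdeg_exists P by blast
      have "zdeg P (f * inverse t) (d + 1)" using zdeg_mult[OF P d zdeg_inverse[OF P t]] by simp
      then have "f * inverse t \<in> P \<longleftrightarrow> d + 1 \<le> 0" by (rule zdeg_mem_iff[OF P])
      moreover have "f \<in> (\<lambda>a. t * a) ` P \<longleftrightarrow> f * inverse t \<in> P"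
        using t0 by (auto simp: field_simps intro!: image_eqI[of _ _ "f * inverse t"])
      moreover have "f \<in> P - place_units P \<longleftrightarrow> d < 0"
        using zdeg_mem_iff[OF P d] zdeg_unit_iff[OF P d] by auto
      ultimately show ?thesis by linarith
    qed
    with t0 show "uniformizer P t" by (auto simp: uniformizer_def)
  }
  assume t: "uniformizer P t"
  then obtain d where d: "zdeg P t d" using zdeg_exists P unfolding uniformizer_def by metis
  have 1: "1 \<in> P" by (rule subring_one[OF valuation_ring_subring[OF infinity_valuation_ring[OF P]]])
  have "t \<in> (\<lambda>a. t * a) ` P" using 1 by force
  then have "t \<in> P - place_units P" using t by (simp add: uniformizer_def)
  then have "d < 0" using zdeg_mem_iff[OF P d] zdeg_unit_iff[OF P d] by auto
  define s where "s = z ^ 2 ^ (n - 3) * inverse x"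
  have s: "zdeg P s (- 1)" unfolding s_def by (rule zdeg_uniformizer)
  then have "s \<in> P - place_units P" using zdeg_mem_iff[OF P s] zdeg_unit_iff[OF P s] by auto
  \<comment> \<open>\<open>s\<close> has a simple zero, so as a multiple of \<open>t\<close> it
    prevents \<open>t\<close> from vanishing to higher order.\<close>
  then obtain a where a: "a \<in> P" "s = t * a" using t by (auto simp: uniformizer_def)
  then have "a \<noteq> 0" using zdeg_nonzero[OF P s] by auto
  then obtain e where e: "zdeg P a e" using zdeg_exists P by blast
  have "d + e = - 1" using zdeg_unique[OF P zdeg_mult[OF P d e]] s a(2) by simp
  moreover have "e \<le> 0" using zdeg_mem_iff[OF P e] a(1) by simp
  ultimately have "d = - 1" using \<open>d < 0\<close> by linarith
  with d show "zdeg P t (- 1)" by simp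
qed

lemma ord_at_eq:
  assumes f: "zdeg P f d"
  shows "ord_at P f = - d"
  unfolding ord_at_def
proof (rule the_equality)
  define t where "t = z ^ 2 ^ (n - 3) * inverse x"
  have t: "zdeg P t (- 1)" unfolding t_def by (rule zdeg_uniformizer)
  have u: "zdeg P (f * t powi d) 0"
    using zdeg_mult[OF P f zdeg_powi[OF P t, of d]] by simp
  then have "f * t powi d \<in> place_units P" by (simp add: zdeg_unit_iff[OF P u])
  moreover have "f = t powi (- d) * (f * t powi d)"
    using zdeg_nonzero[OF P t] by (simp add: power_int_minus)
  ultimately show "\<exists>t u. uniformizer P t \<and> u \<in> place_units P \<and> f = t powi (- d) * u"
    using t uniformizer_iff by blast
next
  fix v assume "\<exists>t u. uniformizer P t \<and> u \<in> place_units P \<and> f = t powi v * u"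
  then obtain t u where t: "zdeg P t (- 1)" and u: "zdeg P u 0" and "f = t powi v * u"
    using uniformizer_iff zdeg_unit[OF P] by blast
  then have "zdeg P f (v * - 1 + 0)" using zdeg_mult[OF P zdeg_powi[OF P t] u] by simp
  then show "v = - d" using zdeg_unique[OF P f] by simp
qed

text \<open>\<open>regular_outside\<close> coincides with \<open>coord_ring\<close>, whose pole
  orders are known; conversely the monomials \<open>x ^ i * y ^ j * z ^ k\<close> realize every
  element.\<close>

theorem weierstrass_semigroup_eq: "weierstrass_semigroup K P = ggs_semigroup m"
proof (intro equalityI subsetI)
  fix r assume "r \<in> weierstrass_semigroup K P"
  then obtain f where f: "f \<noteq> 0" "f \<in> regular_outside" "nat (- ord_at P f) = r"
    by (auto simp: weierstrass_semigroup_def has_pole_divisor_def regular_outside_def)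
  then obtain d where "d \<in> ggs_semigroup m" "zdeg P f (int d)"
    using coord_ring_zdeg regular_subset_coord_ring P by blast
  then show "r \<in> ggs_semigroup m" using ord_at_eq f(3) by simp
next
  fix r assume "r \<in> ggs_semigroup m"
  then obtain i j k where r: "r = 3 * i * m + 2 * j * m + 8 * k"
    by (auto simp: ggs_semigroup_def)
  define f where "f = x ^ i * y ^ j * z ^ k"
  have f: "zdeg P f (int r)"
    using zdeg_mult[OF P zdeg_mult[OF P zdeg_power[OF P zdeg_x[OF P], of i]
        zdeg_power[OF P zdeg_y[OF P], of j]] zdeg_power[OF P zdeg_z[OF P], of k]]
    by (simp add: f_def r algebra_simps)
  have "f \<in> coord_ring" unfolding f_def using generators_mem_coord_ring[OF P] by (intro coord_closed)
  then have "has_pole_divisor K f r P"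
    using coord_ring_subset_regular ord_at_eq[OF f] zdeg_nonzero[OF P f]
    by (auto simp: has_pole_divisor_def regular_outside_def)
  then show "r \<in> weierstrass_semigroup K P" by (auto simp: weierstrass_semigroup_def)
qed

end

end

section \<open>Counting representations in the semigroup\<close>

text \<open>The Apery set of the semigroup: entry \<open>r\<close> is its least element congruent to \<open>r\<close> modulo 8,
  provided that \<open>m\<close> is congruent to 3 modulo 8.\<close>

definition apery :: "nat \<Rightarrow> nat \<Rightarrow> nat" where
  "apery m r = [0, 3 * m, 6 * m, 9 * m, 4 * m, 7 * m, 2 * m, 5 * m] ! r"

text \<open>The count in \<open>nu\<close>, indexed by the element instead of by its
  position.\<close>

definition pair_count :: "nat set \<Rightarrow> nat \<Rightarrow> nat" where
  "pair_count H \<rho> = card {(a, b). a \<in> H \<and> b \<in> H \<and> a + b = \<rho>}"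

lemma less_8_cases:
  fixes r :: nat
  assumes "r < 8"
  obtains "r = 0" | "r = 1" | "r = 2" | "r = 3" | "r = 4" | "r = 5" | "r = 6" | "r = 7"
  using assms by linarith

context
  fixes m :: nat
  assumes m: "m mod 8 = 3"
begin

lemma apery_mod_8:
  assumes "r < 8"
  shows "apery m r mod 8 = r"
proof -
  have c: "c * m mod 8 = c * 3 mod 8" for c by (metis m mod_mult_right_eq)
  show ?thesis using assms by (cases rule: less_8_cases) (simp_all add: apery_def c)
qed

lemma ggs_semigroup_eq_apery: "ggs_semigroup m = {apery m r + 8 * k | r k. r < 8}"
proof (intro equalityI subsetI)
  fix a assume "a \<in> ggs_semigroup m"
  then obtain i j k where a: "a = 3 * i * m + 2 * j * m + 8 * k" and ij: "i \<le> 1" "j \<le> 3"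
    by (auto simp: ggs_semigroup_def)
  have "i = 0 \<or> i = 1" "j = 0 \<or> j = 1 \<or> j = 2 \<or> j = 3" using ij by linarith+
  \<comment> \<open>The table lists the residue of \<open>i + 6 * j\<close> modulo 8, because
    \<open>3 * m\<close> is 1 and \<open>2 * m\<close> is 6 modulo 8.\<close>
  then have "3 * i * m + 2 * j * m = apery m ([[0, 6, 4, 2], [1, 7, 5, 3]] ! i ! j)
    \<and> [[0, 6, 4, 2], [1, 7, 5, 3 :: nat]] ! i ! j < 8"
    by (elim disjE) (simp_all add: apery_def)
  then obtain r where "3 * i * m + 2 * j * m = apery m r" "r < 8" by blast
  with a show "a \<in> {apery m r + 8 * k | r k. r < 8}" by auto
next
  fix a assume "a \<in> {apery m r + 8 * k | r k. r < 8}"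
  then obtain r k where r: "r < 8" and a: "a = apery m r + 8 * k" by blast
  define i j :: nat where "i = [0, 1, 0, 1, 0, 1, 0, 1] ! r" and "j = [0, 0, 3, 3, 2, 2, 1, 1] ! r"
  have "apery m r = 3 * i * m + 2 * j * m \<and> i \<le> 1 \<and> j \<le> 3"
    using r by (cases rule: less_8_cases) (simp_all add: apery_def i_def j_def)
  then show "a \<in> ggs_semigroup m"
    unfolding ggs_semigroup_def a by (intro CollectI exI[of _ i] exI[of _ j] exI[of _ k]) simp
qed

lemma ggs_semigroup_iff_apery: "a \<in> ggs_semigroup m \<longleftrightarrow> apery m (a mod 8) \<le> a"
proof
  assume "a \<in> ggs_semigroup m"
  then show "apery m (a mod 8) \<le> a"
    by (auto simp: ggs_semigroup_eq_apery apery_mod_8)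
next
  assume "apery m (a mod 8) \<le> a"
  moreover have "a mod 8 = apery m (a mod 8) mod 8" by (simp add: apery_mod_8)
  ultimately obtain k where "a = apery m (a mod 8) + 8 * k"
    using mod_eq_nat1E by blast
  then show "a \<in> ggs_semigroup m" unfolding ggs_semigroup_eq_apery by force
qed

text \<open>The residue \<open>r\<close> of the first component fixes that of the second, and each
  component exceeds its Apery element by a multiple of 8. Adding 8 before the division accounts for
  \<open>q = 0\<close>; truncation gives 0 when no pair exists.\<close>

lemma pair_count_eq_sum:
  assumes "s < 8"
  shows "pair_count (ggs_semigroup m) (apery m s + 8 * k)
    = (\<Sum>r<8. (apery m s + 8 * k + 8 - (apery m r + apery m ((s + 8 - r) mod 8))) div 8)"
proof -
  define \<rho> where "\<rho> = apery m s + 8 * k"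
  define c where "c r = (\<rho> + 8 - (apery m r + apery m ((s + 8 - r) mod 8))) div 8" for r
  define B where "B r = (\<lambda>q. (apery m r + 8 * q, \<rho> - (apery m r + 8 * q))) ` {..<c r}" for r
  have \<rho>_mod: "\<rho> mod 8 = s" using apery_mod_8[OF assms] by (simp add: \<rho>_def)
  have other: "b mod 8 = (s + 8 - r) mod 8" if "r < 8" "a mod 8 = r" "a + b = \<rho>" for a b r
  proof -
    define c where "c = s + 8 - r"
    have "c + r = s + 8" using that(1) by (simp add: c_def)
    moreover have "a = r + 8 * (a div 8)" "\<rho> = s + 8 * (\<rho> div 8)"
      using that(2) \<rho>_mod mod_mult_div_eq[of a 8] mod_mult_div_eq[of \<rho> 8] by simp_all
    then obtain A R where "a = r + 8 * A" "\<rho> = s + 8 * R" by blast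
    ultimately have "b + 8 * A + 8 = c + 8 * R" using that(3) by linarith
    then have "b + 8 * Suc A = c + 8 * R" by simp
    then have "b mod 8 = c mod 8" by (metis mod_mult_self2)
    then show ?thesis by (simp add: c_def)
  qed
  have count: "q < c r \<longleftrightarrow> apery m r + 8 * q + apery m ((s + 8 - r) mod 8) \<le> \<rho>" for q r
    unfolding c_def Suc_le_eq[symmetric] by (subst less_eq_div_iff_mult_less_eq) auto
  have "{(a, b). a \<in> ggs_semigroup m \<and> b \<in> ggs_semigroup m \<and> a + b = \<rho>} = (\<Union>r<8. B r)"
  proof (intro equalityI subsetI)
    fix ab assume "ab \<in> {(a, b). a \<in> ggs_semigroup m \<and> b \<in> ggs_semigroup m \<and> a + b = \<rho>}"
    then obtain a b where ab: "ab = (a, b)" "a \<in> ggs_semigroup m" "b \<in> ggs_semigroup m" "a + b = \<rho>"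
      by blast
    from ab(2) obtain r q where a: "r < 8" "a = apery m r + 8 * q"
      by (auto simp: ggs_semigroup_eq_apery)
    have "b mod 8 = (s + 8 - r) mod 8" using other[OF a(1) _ ab(4)] a apery_mod_8 by simp
    then have "q < c r" using ab(3,4) a(2) unfolding count ggs_semigroup_iff_apery by simp
    moreover have "b = \<rho> - (apery m r + 8 * q)" using ab(4) a(2) by simp
    ultimately have "ab \<in> B r" using a(2) ab(1) by (auto simp: B_def)
    then show "ab \<in> (\<Union>r<8. B r)" using a(1) by blast
  next
    fix ab assume "ab \<in> (\<Union>r<8. B r)"
    then obtain r q where r: "r < 8" "q < c r"
      and ab: "ab = (apery m r + 8 * q, \<rho> - (apery m r + 8 * q))"
      by (auto simp: B_def)
    define a where "a = apery m r + 8 * q"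
    define b where "b = \<rho> - a"
    have le: "a + apery m ((s + 8 - r) mod 8) \<le> \<rho>" using r(2) by (simp add: count a_def)
    have sum: "a + b = \<rho>" using le by (simp add: b_def)
    have "b mod 8 = (s + 8 - r) mod 8"
      using other[OF r(1) _ sum] apery_mod_8[OF r(1)] by (simp add: a_def)
    then have "b \<in> ggs_semigroup m" using le sum by (simp add: ggs_semigroup_iff_apery)
    moreover have "a \<in> ggs_semigroup m" using r(1) by (auto simp: ggs_semigroup_eq_apery a_def)
    ultimately show "ab \<in> {(a, b). a \<in> ggs_semigroup m \<and> b \<in> ggs_semigroup m \<and> a + b = \<rho>}"
      using sum by (simp add: ab a_def b_def)
  qed
  moreover have "card (\<Union>r<8. B r) = (\<Sum>r<8. card (B r))"
  proof (rule card_UN_disjoint)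
    show "\<forall>r\<in>{..<8}. \<forall>r'\<in>{..<8}. r \<noteq> r' \<longrightarrow> B r \<inter> B r' = {}"
    proof (intro ballI impI)
      fix r r' :: nat assume rr: "r \<in> {..<8}" "r' \<in> {..<8}" "r \<noteq> r'"
      then have "apery m r + 8 * q \<noteq> apery m r' + 8 * q'" for q q'
        using apery_mod_8[of r] apery_mod_8[of r'] by (metis lessThan_iff mod_mult_self2)
      then show "B r \<inter> B r' = {}" by (auto simp: B_def)
    qed
  qed (auto simp: B_def)
  moreover have "card (B r) = c r" for r
    unfolding B_def by (subst card_image) (auto simp: inj_on_def)
  ultimately show ?thesis by (simp add: pair_count_def c_def \<rho>_def)
qed

text \<open>The three columns count the residue classes whose representations carry 0, 1 or 2 multiples
  of \<open>8 m\<close> when two Apery elements are added.\<close>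

lemma pair_count_formula:
  assumes "s < 8"
  shows "pair_count (ggs_semigroup m) (apery m s + 8 * k)
    = [1, 2, 5, 8, 3, 6, 2, 4] ! s * (k + 1)
    + [5, 6, 3, 0, 5, 2, 5, 4] ! s * (k + 1 - m)
    + [2, 0, 0, 0, 0, 0, 1, 0] ! s * (k + 1 - 2 * m)"
proof -
  have "8 * k + 8 - 8 * c = 8 * (k + 1 - c)" for c by (simp add: diff_mult_distrib2)
  then have carry: "(8 * k + 8 - 8 * c) div 8 = k + 1 - c" for c by simp
  have range8: "{..<8} = {0, 1, 2, 3, 4, 5, 6, 7 :: nat}" by auto
  show ?thesis
    unfolding pair_count_eq_sum[OF assms] range8 using assms
    by (cases rule: less_8_cases)
      (simp_all add: apery_def carry[of m, simplified] carry[of "2 * m", simplified])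
qed

end

subsection \<open>The order bound\<close>

text \<open>Since \<open>enumerate\<close> is strictly increasing, a minimum over indices becomes
  one over elements.\<close>

lemma INF_nu_eq:
  assumes H: "infinite H"
    and lower: "\<And>\<rho>. \<rho> \<in> H \<Longrightarrow> rho H (l + 1) \<le> \<rho> \<Longrightarrow> v \<le> pair_count H \<rho>"
    and attained: "\<rho>' \<in> H" "rho H (l + 1) \<le> \<rho>'" "pair_count H \<rho>' = v"
  shows "(INF r\<in>{l..}. nu H r) = v"
proof -
  \<comment> \<open>The index shift in \<open>nu\<close> cancels the one in
    \<open>rho\<close>.\<close>
  have nu: "nu H r = pair_count H (enumerate H r)" for r
    by (simp add: nu_def pair_count_def rho_def)
  have "v \<in> nu H ` {l..}"
  proof -
    obtain r where r: "\<rho>' = enumerate H r" using attained(1) H enumerate_Ex by metis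
    have "l \<le> r"
      using attained(2) strict_mono_enumerate[OF H] by (simp add: rho_def r strict_mono_less_eq)
    then show ?thesis using attained(3) by (auto simp: nu r)
  qed
  moreover have "v \<le> w" if "w \<in> nu H ` {l..}" for w
  proof -
    obtain r where r: "l \<le> r" "w = pair_count H (enumerate H r)" using \<open>w \<in> _\<close> by (auto simp: nu)
    have "rho H (l + 1) \<le> enumerate H r"
      using r(1) strict_mono_enumerate[OF H] by (simp add: rho_def strict_mono_less_eq)
    then show ?thesis using lower enumerate_in_set[OF H] r(2) by simp
  qed
  ultimately show ?thesis by (intro cInf_eq_minimum)
qed

context
  fixes m :: nat
  assumes m: "m mod 8 = 3" "11 \<le> m"
begin

lemma infinite_ggs_semigroup: "infinite (ggs_semigroup m)"
proof -
  have "range (\<lambda>k. apery m 0 + 8 * k) \<subseteq> ggs_semigroup m"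
    by (auto simp: ggs_semigroup_eq_apery[OF m(1)])
  moreover have "infinite (range (\<lambda>k. apery m 0 + 8 * k))"
    by (rule range_inj_infinite) (simp add: inj_def)
  ultimately show ?thesis by (rule infinite_super)
qed

text \<open>The elements \<open>4 * m\<close>, \<open>5 * m\<close>, \<open>6 * m\<close>,
  \<open>7 * m\<close>, \<open>9 * m\<close> have 3, 4, 5, 6, 8 representations. Each threshold in
  \<open>range\<close> says that \<open>3 * m + 8 * k\<close> has passed one of them, so that
  \<open>v\<close> may exceed its count. The bound \<open>2 * k + 2\<close> comes from
  \<open>3 * m + 8 * k\<close> itself.\<close>

lemma order_bound_lower:
  assumes \<rho>: "\<rho> \<in> ggs_semigroup m" "3 * m + 8 * k \<le> \<rho>" and "k < m"
    and v: "v \<le> 2 * k + 2"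
    and range: "v \<le> 3 \<or> v \<le> 4 \<and> m < 8 * k \<or> v \<le> 5 \<and> 2 * m < 8 * k \<or> v \<le> 6 \<and> 3 * m < 8 * k
      \<or> v \<le> 8 \<and> 4 * m < 8 * k \<or> v + 6 * m \<le> 8 * k + 10 \<and> 3 * m < 4 * k"
  shows "v \<le> pair_count (ggs_semigroup m) \<rho>"
proof -
  obtain u where u: "m = 8 * u + 3" using m(1) by (metis mult.commute div_mult_mod_eq)
  obtain s k' where s: "s < 8" and \<rho>_eq: "\<rho> = apery m s + 8 * k'"
    using \<rho>(1) by (auto simp: ggs_semigroup_eq_apery[OF m(1)])
  have small: "k' = 0 \<or> 1 \<le> k'" by auto
  show ?thesis
    using s
  proof (cases rule: less_8_cases)
    case 1
    then have "3 * m + 8 * k \<le> 0 * m + 8 * k'" using \<rho>(2) \<rho>_eq by (simp add: apery_def)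
    then have "v + 5 * m \<le> 6 * k' + 6 \<or> v \<le> k' + 1"
      using range m(2) \<open>k < m\<close> by (elim disjE conjE; linarith)
    then have "v \<le> k' + 1 + 5 * (k' + 1 - m)" by (cases "m \<le> k' + 1") auto
    with 1 show ?thesis unfolding \<rho>_eq pair_count_formula[OF m(1) s] by simp
  next
    case 2
    then have "3 * m + 8 * k \<le> 3 * m + 8 * k'" using \<rho>(2) \<rho>_eq by (simp add: apery_def)
    then have "v \<le> 2 * k' + 2"
      using v by arith
    with 2 show ?thesis unfolding \<rho>_eq pair_count_formula[OF m(1) s] by simp
  next
    case 3
    then have "3 * m + 8 * k \<le> 6 * m + 8 * k'" using \<rho>(2) \<rho>_eq by (simp add: apery_def)
    then have "v \<le> 5 * k' + 5"
      using range small m(2) \<open>k < m\<close> by (elim disjE conjE; linarith)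
    with 3 show ?thesis unfolding \<rho>_eq pair_count_formula[OF m(1) s] by simp
  next
    case 4
    then have "3 * m + 8 * k \<le> 9 * m + 8 * k'" using \<rho>(2) \<rho>_eq by (simp add: apery_def)
    \<comment> \<open>With \<open>6 * m = 48 * u + 18\<close> the bound on \<open>k'\<close> is
      rounded to an integer, which gains 2 and accounts for the 10 in \<open>range\<close>.\<close>
    moreover from this u have "k \<le> k' + 6 * u + 2" by linarith
    ultimately have "v \<le> 8 * k' + 8"
      using range u by (elim disjE conjE; linarith)
    with 4 show ?thesis unfolding \<rho>_eq pair_count_formula[OF m(1) s] by simp
  next
    case 5
    then have "3 * m + 8 * k \<le> 4 * m + 8 * k'" using \<rho>(2) \<rho>_eq by (simp add: apery_def)
    then have "v \<le> 3 * k' + 3"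
      using range small m(2) \<open>k < m\<close> by (elim disjE conjE; linarith)
    with 5 show ?thesis unfolding \<rho>_eq pair_count_formula[OF m(1) s] by simp
  next
    case 6
    then have "3 * m + 8 * k \<le> 7 * m + 8 * k'" using \<rho>(2) \<rho>_eq by (simp add: apery_def)
    then have "v \<le> 6 * k' + 6"
      using range small m(2) \<open>k < m\<close> by (elim disjE conjE; linarith)
    with 6 show ?thesis unfolding \<rho>_eq pair_count_formula[OF m(1) s] by simp
  next
    case 7
    then have "3 * m + 8 * k \<le> 2 * m + 8 * k'" using \<rho>(2) \<rho>_eq by (simp add: apery_def)
    then have "v \<le> 2 * k' + 2"
      using v by arith
    with 7 show ?thesis unfolding \<rho>_eq pair_count_formula[OF m(1) s] by simp
  next
    case 8
    then have "3 * m + 8 * k \<le> 5 * m + 8 * k'" using \<rho>(2) \<rho>_eq by (simp add: apery_def)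
    then have "v \<le> 4 * k' + 4"
      using range small m(2) \<open>k < m\<close> by (elim disjE conjE; linarith)
    with 8 show ?thesis unfolding \<rho>_eq pair_count_formula[OF m(1) s] by simp
  qed
qed

end

section \<open>Evaluation of the order bound\<close>

theorem lemma3p4:
  fixes n m l k :: nat
    and K P_inf :: "'f::field set"
    and x y z :: 'f
    and H :: "nat set"
  assumes n: "n \<ge> 5" "odd n"
    and curve: "GGS2_function_field n m K x y z"
    and P_inf: "point_at_infinity K x y z P_inf"
    and H: "H = weierstrass_semigroup K P_inf"
    and l: "l \<ge> 1"
    and k: "k < m"
    and rho: "rho H (l + 1) = 3 * m + 8 * k"
  shows
    "(k = 0 \<longrightarrow> d_ORD K P_inf l = 2)
   \<and> (1 \<le> k \<and> int k \<le> \<lfloor>real m / 8\<rfloor> \<longrightarrow> d_ORD K P_inf l = 3)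
   \<and> (real m / 8 < real k \<and> int k \<le> \<lfloor>real m / 4\<rfloor> \<longrightarrow> d_ORD K P_inf l = 4)
   \<and> (real m / 4 < real k \<and> int k \<le> \<lfloor>3 * real m / 8\<rfloor> \<longrightarrow> d_ORD K P_inf l = 5)
   \<and> (3 * real m / 8 < real k \<and> int k \<le> \<lfloor>real m / 2\<rfloor> \<longrightarrow> d_ORD K P_inf l = 6)
   \<and> (real m / 2 < real k \<and> int k \<le> \<lfloor>3 * real m / 4\<rfloor> \<longrightarrow> d_ORD K P_inf l = 8)
   \<and> (3 * real m / 4 \<le> real k \<and> k \<le> m - 2 \<longrightarrow>
        int (d_ORD K P_inf l) = 8 * (\<lceil>real k - 3 * real m / 4\<rceil> + 1))
   \<and> (k = m - 1 \<longrightarrow> d_ORD K P_inf l = nu H l \<and> nu H l = 2 * m)"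
proof -
  interpret GGS2_odd n m K x y z
    using curve n by (simp add: GGS2_odd_def GGS2_odd_axioms_def)
  have H_eq: "H = ggs_semigroup m" using weierstrass_semigroup_eq[OF P_inf] H by simp
  have "(2 :: nat) ^ 5 \<le> 2 ^ n" by (rule power_increasing) (use n in auto)
  then have m: "11 \<le> m" using three_m by simp
  obtain u where "m = 8 * u + 3" using m_mod_8 by (metis mult.commute div_mult_mod_eq)
  then have "3 * m = 4 * (6 * u + 2) + 1" by simp
  then obtain w where w: "3 * m = 4 * w + 1" by blast
  \<comment> \<open>It suffices to find an element not below \<open>3 * m + 8 * k\<close> whose
    count attains the lower bound \<open>v\<close>. With \<open>k' < m\<close> only the first column
    of the formula is nonzero.\<close>
  have d: "d_ORD K P_inf l = v"
    if "v \<le> 2 * k + 2"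
      and "v \<le> 3 \<or> v \<le> 4 \<and> m < 8 * k \<or> v \<le> 5 \<and> 2 * m < 8 * k \<or> v \<le> 6 \<and> 3 * m < 8 * k
        \<or> v \<le> 8 \<and> 4 * m < 8 * k \<or> v + 6 * m \<le> 8 * k + 10 \<and> 3 * m < 4 * k"
      and "s < 8" "k' < m" "3 * m + 8 * k \<le> apery m s + 8 * k'"
      and "v = [1, 2, 5, 8, 3, 6, 2, 4] ! s * (k' + 1)" for v s k'
  proof -
    have "pair_count H (apery m s + 8 * k') = v"
      using that(4,6) by (simp add: H_eq pair_count_formula[OF m_mod_8 that(3)])
    moreover have "apery m s + 8 * k' \<in> H"
      using that(3) by (auto simp: H_eq ggs_semigroup_eq_apery[OF m_mod_8])
    moreover have "v \<le> pair_count H \<rho>" if "\<rho> \<in> H" "rho H (l + 1) \<le> \<rho>" for \<rho>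
      using order_bound_lower[OF m_mod_8 m _ _ k \<open>v \<le> 2 * k + 2\<close> \<open>v \<le> 3 \<or> _\<close>, of \<rho>] that
      unfolding H_eq[symmetric] rho by blast
    ultimately show ?thesis
      unfolding d_ORD_def H[symmetric] using that(5) infinite_ggs_semigroup[OF m_mod_8 m]
      unfolding H_eq[symmetric] by (intro INF_nu_eq) (auto simp only: rho)
  qed
  \<comment> \<open>In the first six cases the minimum is attained at the first of
    \<open>3 * m\<close>, \<open>4 * m\<close>, \<open>5 * m\<close>, \<open>6 * m\<close>,
    \<open>7 * m\<close>, \<open>9 * m\<close> that is not below
    \<open>3 * m + 8 * k\<close>.\<close>
  have "d_ORD K P_inf l = 2" if "k = 0"
    by (rule d[of _ 1 0]) (use that m in \<open>auto simp: apery_def\<close>)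
  moreover have "d_ORD K P_inf l = 3" if "1 \<le> k" "int k \<le> \<lfloor>real m / 8\<rfloor>"
  proof -
    have "8 * k \<le> m" using that(2) by (simp add: le_floor_iff)
    then show ?thesis by (intro d[of _ 4 0]) (use that m in \<open>auto simp: apery_def\<close>)
  qed
  moreover have "d_ORD K P_inf l = 4" if "real m / 8 < real k" "int k \<le> \<lfloor>real m / 4\<rfloor>"
  proof -
    have "m < 8 * k" "4 * k \<le> m" using that by (simp_all add: le_floor_iff)
    then show ?thesis by (intro d[of _ 7 0]) (use m in \<open>auto simp: apery_def\<close>)
  qed
  moreover have "d_ORD K P_inf l = 5" if "real m / 4 < real k" "int k \<le> \<lfloor>3 * real m / 8\<rfloor>"
  proof -
    have "m < 4 * k" "8 * k \<le> 3 * m" using that by (simp_all add: le_floor_iff)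
    then show ?thesis by (intro d[of _ 2 0]) (use m in \<open>auto simp: apery_def\<close>)
  qed
  moreover have "d_ORD K P_inf l = 6" if "3 * real m / 8 < real k" "int k \<le> \<lfloor>real m / 2\<rfloor>"
  proof -
    have "3 * m < 8 * k" "2 * k \<le> m" using that by (simp_all add: le_floor_iff)
    then show ?thesis by (intro d[of _ 5 0]) (use m in \<open>auto simp: apery_def\<close>)
  qed
  moreover have "d_ORD K P_inf l = 8" if "real m / 2 < real k" "int k \<le> \<lfloor>3 * real m / 4\<rfloor>"
  proof -
    have "m < 2 * k" "4 * k \<le> 3 * m" using that by (simp_all add: le_floor_iff)
    then show ?thesis by (intro d[of _ 3 0]) (use m in \<open>auto simp: apery_def\<close>)
  qed
  moreover have "int (d_ORD K P_inf l) = 8 * (\<lceil>real k - 3 * real m / 4\<rceil> + 1)"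
    if "3 * real m / 4 \<le> real k" "k \<le> m - 2"
  proof -
    have "3 * m \<le> 4 * k" using that(1) by simp
    then have "w + 1 \<le> k" using w by linarith
    then obtain j where j: "k = w + 1 + j" by (auto simp: le_iff_add)
    \<comment> \<open>As \<open>3 * m = 4 * w + 1\<close>, the ceiling is
      \<open>k - w = j + 1\<close>; the minimum is attained at \<open>9 * m + 8 * (j + 1)\<close>.
      The condition \<open>k \<le> m - 2\<close> keeps \<open>8 * (j + 2)\<close> within
      \<open>2 * k + 2\<close>.\<close>
    have "d_ORD K P_inf l = 8 * (j + 2)"
      by (rule d[of _ 3 "j + 1"]) (use j w that(2) m in \<open>auto simp: apery_def\<close>)
    moreover have "\<lceil>real k - 3 * real m / 4\<rceil> = int j + 1"
      using j w by (simp add: ceiling_eq_iff)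
    ultimately show ?thesis by simp
  qed
  moreover have "d_ORD K P_inf l = nu H l \<and> nu H l = 2 * m" if "k = m - 1"
  proof -
    have "rho H (l + 1) = apery m 1 + 8 * k" using rho by (simp add: apery_def)
    then have "nu H l = pair_count (ggs_semigroup m) (apery m 1 + 8 * k)"
      by (simp add: nu_def pair_count_def H_eq)
    also have "\<dots> = 2 * m" using that m by (simp add: pair_count_formula[OF m_mod_8])
    finally have "nu H l = 2 * m" .
    \<comment> \<open>For \<open>k = m - 1\<close> the preceding formula would give
      \<open>2 * m + 2\<close>, but \<open>3 * m + 8 * k\<close> itself has only
      \<open>2 * m\<close> representations.\<close>
    moreover have "d_ORD K P_inf l = 2 * m"
      by (rule d[of _ 1 k]) (use that m in \<open>auto simp: apery_def\<close>)
    ultimately show ?thesis by simp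
  qed
  ultimately show ?thesis by blast
qed

end
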